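(* For all $T,M>0$, $$-\lim_{u\to\infty}\frac{1}{\sqrt{u}}\log\mathbb{P}\left(\int_0^{T\sqrt{u}}Q(r)\,\mathrm{d}r\ge Mu\right)=\varphi(T,M),$$ where $$\varphi(T,M):=\begin{cases}\frac{2}{3}\sqrt{6}\,c\sqrt{cM}, & \text{if }\sqrt{6M/c}<T,\\[2pt] \dfrac{2cM}{T}+\dfrac{c^2T}{3}, & \text{otherwise.}\end{cases}$$
   Context: $\{B(t):t\in\mathbb{R}\}$ is a two-sided standard Brownian motion ($B(0)=0$, $\mathbb{E}B(t)=0$, $\mathrm{Var}\,B(t)=|t|$), and $c>0$ is a fixed constant. The stationary workload (Brownian storage) process is $Q(t)=\sup_{s\le t}\left(B(t)-B(s)-c(t-s)\right)$, $t\in\mathbb{R}$. *)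

theory Defs
  imports "HOL-Probability.Probability"
begin

text \<open>
  Continuity of the paths and \<open>B 0 = 0\<close> are required for every outcome of the probability
  space, not just almost surely. The probability space need not be complete, and this makes
  events depending on a whole path, such as those about the workload below, measurable.
  The increments over finitely many consecutive intervals, located anywhere on the real line,
  are independent.
\<close>

locale two_sided_brownian_motion = prob_space M for M :: "'a measure" +
  fixes B :: "real \<Rightarrow> 'a \<Rightarrow> real"
  assumes random_variable_B: "\<And>t. random_variable borel (B t)"
    and B_zero: "\<And>\<omega>. \<omega> \<in> space M \<Longrightarrow> B 0 \<omega> = 0"
    and continuous_paths: "\<And>\<omega>. \<omega> \<in> space M \<Longrightarrow> continuous_on UNIV (\<lambda>t. B t \<omega>)"
    and normal_increments: "\<And>s t. s < t \<Longrightarrow>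
          distributed M lborel (\<lambda>\<omega>. B t \<omega> - B s \<omega>) (normal_density 0 (sqrt (t - s)))"
    and independent_increments: "\<And>(n :: nat) (t :: nat \<Rightarrow> real). strict_mono_on {..n} t \<Longrightarrow>
          indep_vars (\<lambda>_. borel) (\<lambda>i \<omega>. B (t (Suc i)) \<omega> - B (t i) \<omega>) {..<n}"
begin

lemma
  shows expectation_B: "expectation (B t) = 0"
    and variance_B: "variance (B t) = \<bar>t\<bar>"
proof -
  have "expectation (B t) = 0 \<and> expectation (\<lambda>\<omega>. (B t \<omega>)\<^sup>2) = \<bar>t\<bar>"
  proof (cases t "0 :: real" rule: linorder_cases)
    case less
    have *: "expectation (\<lambda>\<omega>. B 0 \<omega> - B t \<omega>) = 0"
      using normal_distributed_expectation[OF _ normal_increments[OF less]] less by simp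
    moreover have "expectation (\<lambda>\<omega>. (B 0 \<omega> - B t \<omega>)\<^sup>2) = \<bar>t\<bar>"
      using normal_distributed_variance[OF _ normal_increments[OF less]] less * by simp
    moreover have "expectation (\<lambda>\<omega>. B 0 \<omega> - B t \<omega>) = expectation (\<lambda>\<omega>. - B t \<omega>)"
      by (intro Bochner_Integration.integral_cong) (auto simp: B_zero)
    moreover have "expectation (\<lambda>\<omega>. (B 0 \<omega> - B t \<omega>)\<^sup>2) = expectation (\<lambda>\<omega>. (B t \<omega>)\<^sup>2)"
      by (intro Bochner_Integration.integral_cong) (auto simp: B_zero)
    ultimately show ?thesis by simp
  next
    case equal
    have "expectation (B 0) = expectation (\<lambda>_. 0)"
      by (intro Bochner_Integration.integral_cong) (auto simp: B_zero)
    moreover have "expectation (\<lambda>\<omega>. (B 0 \<omega>)\<^sup>2) = expectation (\<lambda>_. 0)"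
      by (intro Bochner_Integration.integral_cong) (auto simp: B_zero)
    ultimately show ?thesis using equal by simp
  next
    case greater
    have *: "expectation (\<lambda>\<omega>. B t \<omega> - B 0 \<omega>) = 0"
      using normal_distributed_expectation[OF _ normal_increments[OF greater]] greater by simp
    moreover have "expectation (\<lambda>\<omega>. (B t \<omega> - B 0 \<omega>)\<^sup>2) = \<bar>t\<bar>"
      using normal_distributed_variance[OF _ normal_increments[OF greater]] greater * by simp
    moreover have "expectation (\<lambda>\<omega>. B t \<omega> - B 0 \<omega>) = expectation (B t)"
      by (intro Bochner_Integration.integral_cong) (auto simp: B_zero)
    moreover have "expectation (\<lambda>\<omega>. (B t \<omega> - B 0 \<omega>)\<^sup>2) = expectation (\<lambda>\<omega>. (B t \<omega>)\<^sup>2)"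
      by (intro Bochner_Integration.integral_cong) (auto simp: B_zero)
    ultimately show ?thesis by simp
  qed
  then show "expectation (B t) = 0" "variance (B t) = \<bar>t\<bar>" by simp_all
qed

end

text \<open>
  The supremum is finite only almost surely, so it is taken in the extended reals.
\<close>

definition workload :: "real \<Rightarrow> (real \<Rightarrow> 'a \<Rightarrow> real) \<Rightarrow> real \<Rightarrow> 'a \<Rightarrow> ereal" where
  "workload c B t \<omega> = (SUP s\<in>{..t}. ereal (B t \<omega> - B s \<omega> - c * (t - s)))"

lemma workload_nonneg: "0 \<le> workload c B t \<omega>"
  unfolding workload_def by (rule SUP_upper2[of t]) simp_all

text \<open>
  By \<open>workload_nonneg\<close>, the coercion \<^const>\<open>e2ennreal\<close>, which sends negative values to zero,
  preserves all values of the workload.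
\<close>

definition workload_area :: "real \<Rightarrow> (real \<Rightarrow> 'a \<Rightarrow> real) \<Rightarrow> real \<Rightarrow> 'a \<Rightarrow> ennreal" where
  "workload_area c B t \<omega> = (\<integral>\<^sup>+ r\<in>{0..t}. e2ennreal (workload c B r \<omega>) \<partial>lborel)"

definition decay_rate :: "real \<Rightarrow> real \<Rightarrow> real \<Rightarrow> real" where
  "decay_rate c T M =
     (if sqrt (6 * M / c) < T then 2 / 3 * sqrt 6 * c * sqrt (c * M)
      else 2 * c * M / T + c\<^sup>2 * T / 3)"

end

theory Submission
  imports Defs
begin

text \<open>
  If \<open>s r \<le> r\<close> selects the maximising time in the definition of the workload at time \<open>r\<close>, the area
  over \<open>[0, T]\<close> is linear in the increments of \<open>B\<close>, hence Gaussian, with weight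
  \<open>g v = |{r. s r \<le> v < r}|\<close>. As \<open>v\<close> grows, \<open>g\<close> descends with slope at most one, so it spends at
  least the length \<open>dx\<close> in every level \<open>dx\<close> below its maximum \<open>G \<le> T\<close>; therefore the integral of
  \<open>g (G - g)\<close> is at least \<open>G\<^sup>3 / 6\<close>, and Chernoff's bound with tilt \<open>2 c / G\<close> gives the rate
  \<open>2 c M / G + c\<^sup>2 G / 3\<close>. Its infimum over \<open>0 < G \<le> T\<close> is the decay rate.

  On the time scale \<open>sqrt u\<close>, a fixed grid leaves finitely many selections, so a union bound costs
  nothing on the exponential scale; oscillations within the cells of a fine grid and the remote past
  are controlled by dyadic chaining. Conversely, the constant selection
  \<open>s = - (M / (c S) - S / 6)\<close> with the horizon \<open>S = min T (sqrt (6 M / c))\<close> attains the rate.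
\<close>

section \<open>Gaussian tails\<close>

text \<open>Exponential tilting: \<open>exp (l * y)\<close> times the centred density is a constant
  times the normal density with mean \<open>l * \<sigma>^2\<close>, and
  \<open>exp (l * (y - x)) \<ge> 1\<close> on the tail. The tilt stays free because its later choice
  depends on the maximal weight of a selection rather than on the variance.\<close>

lemma (in prob_space) normal_tail_upper:
  assumes X: "distributed M lborel X (normal_density 0 \<sigma>)" and "\<sigma> > 0" "l \<ge> 0"
  shows "prob {\<omega> \<in> space M. X \<omega> \<ge> x} \<le> exp (- (l * x) + l\<^sup>2 * \<sigma>\<^sup>2 / 2)"
proof -
  have shift: "normal_density 0 \<sigma> y * exp (l * y) = exp (l\<^sup>2 * \<sigma>\<^sup>2 / 2) * normal_density (l * \<sigma>\<^sup>2) \<sigma> y" for y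
  proof -
    have "- (y - 0)\<^sup>2 / (2 * \<sigma>\<^sup>2) + l * y = l\<^sup>2 * \<sigma>\<^sup>2 / 2 + - (y - l * \<sigma>\<^sup>2)\<^sup>2 / (2 * \<sigma>\<^sup>2)"
      using \<open>\<sigma> > 0\<close> by (simp add: field_simps power2_eq_square)
    then show ?thesis
      unfolding normal_density_def by (simp add: exp_add[symmetric] mult.assoc)
  qed
  have "emeasure M {\<omega> \<in> space M. X \<omega> \<ge> x} = emeasure M (X -` {x..} \<inter> space M)"
    by (rule arg_cong[where f="emeasure M"]) auto
  also have "\<dots> = (\<integral>\<^sup>+ y. ennreal (normal_density 0 \<sigma> y) * indicator {x..} y \<partial>lborel)"
    by (subst distributed_emeasure[OF X]) auto
  also have "\<dots> \<le> (\<integral>\<^sup>+ y. ennreal (exp (- (l * x) + l\<^sup>2 * \<sigma>\<^sup>2 / 2)) * ennreal (normal_density (l * \<sigma>\<^sup>2) \<sigma> y) \<partial>lborel)"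
  proof (rule nn_integral_mono)
    fix y :: real
    have "normal_density 0 \<sigma> y * 1 \<le> normal_density 0 \<sigma> y * exp (l * y - l * x)" if "x \<le> y"
      using that \<open>l \<ge> 0\<close> by (intro mult_left_mono) (auto simp: mult_left_mono)
    also have "normal_density 0 \<sigma> y * exp (l * y - l * x)
        = exp (- (l * x) + l\<^sup>2 * \<sigma>\<^sup>2 / 2) * normal_density (l * \<sigma>\<^sup>2) \<sigma> y"
      using shift[of y] by (simp add: exp_diff)
    finally show "ennreal (normal_density 0 \<sigma> y) * indicator {x..} y
        \<le> ennreal (exp (- (l * x) + l\<^sup>2 * \<sigma>\<^sup>2 / 2)) * ennreal (normal_density (l * \<sigma>\<^sup>2) \<sigma> y)"
      by (auto simp: indicator_def ennreal_mult[symmetric] intro!: ennreal_leI)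
  qed
  also have "\<dots> = ennreal (exp (- (l * x) + l\<^sup>2 * \<sigma>\<^sup>2 / 2))"
    using \<open>\<sigma> > 0\<close> by (subst nn_integral_cmult)
      (auto simp: nn_integral_eq_integral)
  finally show ?thesis
    by (simp add: emeasure_eq_measure)
qed

text \<open>The density decreases on \<open>[x, x + 1]\<close>, so the tail is at least its value at
  the right end times the unit length. The shift by one is of lower order when \<open>x\<close> and
  the variance grow proportionally.\<close>

lemma (in prob_space) normal_tail_lower:
  assumes X: "distributed M lborel X (normal_density 0 \<sigma>)" and "\<sigma> > 0" "x \<ge> 0"
  shows "prob {\<omega> \<in> space M. X \<omega> \<ge> x} \<ge> exp (- (x + 1)\<^sup>2 / (2 * \<sigma>\<^sup>2)) / sqrt (2 * pi * \<sigma>\<^sup>2)"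
proof -
  have "ennreal (normal_density 0 \<sigma> (x + 1)) =
      (\<integral>\<^sup>+ y. ennreal (normal_density 0 \<sigma> (x + 1)) * indicator {x..x+1} y \<partial>lborel)"
    by (subst nn_integral_cmult_indicator) auto
  also have "\<dots> \<le> (\<integral>\<^sup>+ y. ennreal (normal_density 0 \<sigma> y) * indicator {x..} y \<partial>lborel)"
  proof (rule nn_integral_mono)
    fix y :: real
    have "normal_density 0 \<sigma> (x + 1) \<le> normal_density 0 \<sigma> y" if "x \<le> y" "y \<le> x + 1"
    proof -
      have "y\<^sup>2 \<le> (x + 1)\<^sup>2" using that \<open>x \<ge> 0\<close> by (intro power_mono) auto
      then show ?thesis
        using \<open>\<sigma> > 0\<close> by (auto simp: normal_density_def intro!: divide_right_mono mult_left_mono)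
    qed
    then show "ennreal (normal_density 0 \<sigma> (x + 1)) * indicator {x..x+1} y
        \<le> ennreal (normal_density 0 \<sigma> y) * indicator {x..} y"
      by (auto simp: indicator_def intro!: ennreal_leI)
  qed
  also have "\<dots> = emeasure M (X -` {x..} \<inter> space M)"
    by (subst distributed_emeasure[OF X]) auto
  also have "\<dots> = emeasure M {\<omega> \<in> space M. X \<omega> \<ge> x}"
    by (rule arg_cong[where f="emeasure M"]) auto
  finally show ?thesis
    by (simp add: emeasure_eq_measure normal_density_def)
qed

text \<open>Both one-sided tails are taken with the optimal tilt
  \<open>x / \<sigma>^2\<close>.\<close>

lemma (in prob_space) normal_tail_abs:
  assumes X: "distributed M lborel X (normal_density 0 \<sigma>)" and "\<sigma> > 0" "x \<ge> 0"
  shows "prob {\<omega> \<in> space M. \<bar>X \<omega>\<bar> > x} \<le> 2 * exp (- (x\<^sup>2 / (2 * \<sigma>\<^sup>2)))"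
proof -
  have [measurable]: "random_variable borel X"
    using distributed_measurable[OF X] by simp
  have X': "distributed M lborel (\<lambda>\<omega>. - X \<omega>) (normal_density 0 \<sigma>)"
    using normal_density_affine[OF X \<open>\<sigma> > 0\<close>, of "-1" 0] by simp
  have eq: "- (x / \<sigma>\<^sup>2 * x) + (x / \<sigma>\<^sup>2)\<^sup>2 * \<sigma>\<^sup>2 / 2 = - (x\<^sup>2 / (2 * \<sigma>\<^sup>2))"
    using \<open>\<sigma> > 0\<close> by (simp add: field_simps power2_eq_square)
  have tail: "prob {\<omega> \<in> space M. Y \<omega> \<ge> x} \<le> exp (- (x\<^sup>2 / (2 * \<sigma>\<^sup>2)))"
    if "distributed M lborel Y (normal_density 0 \<sigma>)" for Y
    using normal_tail_upper[OF that \<open>\<sigma> > 0\<close>, of "x / \<sigma>\<^sup>2" x] \<open>x \<ge> 0\<close> unfolding eq by simp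
  have "prob {\<omega> \<in> space M. \<bar>X \<omega>\<bar> > x}
      \<le> prob ({\<omega> \<in> space M. X \<omega> \<ge> x} \<union> {\<omega> \<in> space M. - X \<omega> \<ge> x})"
    by (intro finite_measure_mono) (auto simp: abs_if split: if_splits)
  also have "\<dots> \<le> prob {\<omega> \<in> space M. X \<omega> \<ge> x} + prob {\<omega> \<in> space M. - X \<omega> \<ge> x}"
    by (intro measure_Un_le) auto
  finally show ?thesis using tail[OF X] tail[OF X'] by simp
qed

text \<open>The Gaussian lower bound for a deviation \<open>n * a\<close> and a variance
  \<open>n * v\<close> has exponential rate \<open>a^2 / (2 * v)\<close>. Its gap
  \<open>\<delta>\<close> to \<open>r\<close> absorbs the polynomial prefactor; the gap
  \<open>b - r\<close> absorbs the subtracted error.\<close>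

lemma eventually_gaussian_tail_ge:
  fixes a v r b C :: real
  assumes "a \<ge> 0" "v > 0" "a\<^sup>2 / (2 * v) < r" "r < b" "C \<ge> 0"
  shows "\<forall>\<^sub>F n in at_top. exp (- (n * a + 1)\<^sup>2 / (2 * (n * v))) / sqrt (2 * pi * (n * v)) - C * exp (- (n * b))
    \<ge> exp (- (n * r))"
proof -
  define \<delta> where "\<delta> = r - a\<^sup>2 / (2 * v)"
  \<comment> \<open>This collects the part of the exponent that stays bounded in \<open>n\<close>:
    expanding the square leaves \<open>a / v + 1 / (2 * (n * v))\<close>, whose last term is
    eventually at most one.\<close>
  define \<kappa> where "\<kappa> = exp (- (a / v + 1))"
  have pos: "\<delta> > 0" "\<kappa> > 0" "b - r > 0" using assms by (auto simp: \<delta>_def \<kappa>_def)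
  have "\<forall>\<^sub>F n in at_top. n \<ge> 1 \<and> n \<ge> 2 * pi * v \<and> n \<ge> 1 / (2 * v) \<and> n \<ge> 4 / (\<kappa> * \<delta>\<^sup>2) \<and> n \<ge> C / (b - r)"
    by (intro eventually_conj eventually_ge_at_top)
  then show ?thesis
  proof eventually_elim
    case (elim n)
    then have n: "n \<ge> 1" "n > 0" "n \<ge> 2 * pi * v" "1 / (2 * (n * v)) \<le> 1" "n * (\<kappa> * \<delta>\<^sup>2) \<ge> 4" "n * (b - r) \<ge> C"
      using pos \<open>v > 0\<close> by (auto simp: field_simps)
    have "sqrt (2 * pi * (n * v)) \<le> sqrt (n * n)"
      using mult_left_mono[OF n(3), of n] n(2) by (intro real_sqrt_le_mono) (simp add: algebra_simps)
    then have sqrt_le: "sqrt (2 * pi * (n * v)) \<le> n" using n(2) by simp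
    have sq: "(n * a + 1)\<^sup>2 / (2 * (n * v)) = n * (a\<^sup>2 / (2 * v)) + a / v + 1 / (2 * (n * v))"
      using n(2) \<open>v > 0\<close> by (simp add: field_simps power2_eq_square)
    have "2 * n = n * 4 / 2" by simp
    also have "\<dots> \<le> n * (n * (\<kappa> * \<delta>\<^sup>2)) / 2" using n by (intro divide_right_mono mult_left_mono) auto
    also have "\<dots> = \<kappa> * ((n * \<delta>)\<^sup>2 / 2)" by (simp add: power2_eq_square)
    also have "\<dots> \<le> \<kappa> * exp (n * \<delta>)"
    proof (intro mult_left_mono)
      show "(n * \<delta>)\<^sup>2 / 2 \<le> exp (n * \<delta>)"
      proof -
        have "0 \<le> n * \<delta>" using n(2) pos by simp
        then show ?thesis using exp_lower_Taylor_quadratic[of "n * \<delta>"] by linarith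
      qed
    qed (use pos in simp)
    \<comment> \<open>The factor two is deliberate: one copy of \<open>exp (- (n * r))\<close> is
      the claim, the other pays for \<open>C * exp (- (n * b))\<close>.\<close>
    finally have "2 * n * exp (- (n * r)) \<le> \<kappa> * exp (n * \<delta>) * exp (- (n * r))"
      by (intro mult_right_mono) auto
    also have "\<dots> = exp (- (n * (a\<^sup>2 / (2 * v)) + a / v + 1))"
      by (simp add: \<kappa>_def \<delta>_def exp_add[symmetric] algebra_simps)
    also have "\<dots> \<le> exp (- (n * a + 1)\<^sup>2 / (2 * (n * v)))"
      using sq n(4) by simp
    finally have "2 * exp (- (n * r)) * n \<le> exp (- (n * a + 1)\<^sup>2 / (2 * (n * v)))" by (simp add: mult.commute mult.left_commute)
    then have "2 * exp (- (n * r)) \<le> exp (- (n * a + 1)\<^sup>2 / (2 * (n * v))) / n"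
      using n(2) by (simp add: le_divide_eq)
    also have "\<dots> \<le> exp (- (n * a + 1)\<^sup>2 / (2 * (n * v))) / sqrt (2 * pi * (n * v))"
      using sqrt_le n(2) \<open>v > 0\<close> by (intro divide_left_mono) auto
    finally have 1: "2 * exp (- (n * r)) \<le> exp (- (n * a + 1)\<^sup>2 / (2 * (n * v))) / sqrt (2 * pi * (n * v))" .
    have "C \<le> exp (n * (b - r))"
      using n(6) exp_ge_add_one_self[of "n * (b - r)"] by linarith
    then have "C * exp (- (n * b)) \<le> exp (n * (b - r)) * exp (- (n * b))" by (intro mult_right_mono) auto
    also have "\<dots> = exp (- (n * r))" by (simp add: exp_add[symmetric] algebra_simps)
    finally show ?case using 1 by linarith
  qed
qed

section \<open>Selections on a grid\<close>

text \<open>Discrete counterpart of the integral of \<open>x * (G - x)\<close> over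
  \<open>[0, G]\<close>, which is \<open>G^3 / 6\<close>.\<close>

lemma sum_mult_diff_atMost: "(\<Sum>x\<le>H. real x * (real H - real x)) = (real H ^ 3 - real H) / 6"
proof -
  have 1: "(\<Sum>x\<le>H. real x) = real H * (real H + 1) / 2"
    by (induction H) (auto simp: field_simps)
  have 2: "(\<Sum>x\<le>H. (real x)\<^sup>2) = real H * (real H + 1) * (2 * real H + 1) / 6"
    by (induction H) (auto simp: field_simps power2_eq_square)
  have "(\<Sum>x\<le>H. real x * (real H - real x)) = real H * (\<Sum>x\<le>H. real x) - (\<Sum>x\<le>H. (real x)\<^sup>2)"
    by (simp add: sum_distrib_left sum_subtractf[symmetric] power2_eq_square algebra_simps)
  also have "\<dots> = (real H ^ 3 - real H) / 6"
    unfolding 1 2 by (simp add: field_simps power2_eq_square power3_eq_cube)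
  finally show ?thesis .
qed

text \<open>
  Since \<open>h\<close> descends by unit steps only, it takes every value between its maximum and zero.
\<close>

lemma sum_slow_descent:
  fixes h :: "nat \<Rightarrow> nat"
  assumes step: "\<And>k. h k \<le> Suc (h (Suc k))" and zero: "\<And>k. k \<ge> N \<Longrightarrow> h k = 0"
    and max: "\<And>k. h k \<le> H" "H = h k\<^sub>0"
  shows "(\<Sum>k<N. real (h k) * (real H - real (h k))) \<ge> (real H ^ 3 - real H) / 6"
proof -
  have attained: "x \<in> h ` {..<N}" if x: "1 \<le> x" "x \<le> H" for x
  proof -
    \<comment> \<open>The last index with value at least \<open>x\<close>: one step later the value
      is below \<open>x\<close>, and a descent by at most one forces \<open>h k = x\<close>.\<close>
    define k where "k = Max {k. h k \<ge> x}"
    have sub: "{k. h k \<ge> x} \<subseteq> {..<N}"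
    proof
      fix k assume "k \<in> {k. h k \<ge> x}"
      then have "h k \<noteq> 0" using x by auto
      then show "k \<in> {..<N}" using zero[of k] by (cases "k < N") auto
    qed
    then have fin: "finite {k. h k \<ge> x}" by (rule finite_subset) simp
    have k: "k \<in> {k. h k \<ge> x}"
      unfolding k_def using max x fin by (intro Max_in) auto
    have "Suc k \<notin> {k. h k \<ge> x}"
      using Max_ge[OF fin, of "Suc k"] unfolding k_def by auto
    then have "h k = x" using step[of k] k by auto
    moreover have "k < N" using sub k by blast
    ultimately show ?thesis by blast
  qed
  have "(real H ^ 3 - real H) / 6 = (\<Sum>x\<in>{1..H}. real x * (real H - real x))"
    unfolding sum_mult_diff_atMost[symmetric] by (rule sum.mono_neutral_right) (auto simp: Suc_le_eq)
  also have "\<dots> \<le> (\<Sum>x\<in>h ` {..<N}. real x * (real H - real x))"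
    using attained max by (intro sum_mono2) auto
  \<comment> \<open>Only one term per attained value was kept; the remaining ones are nonnegative
    because \<open>h k \<le> H\<close>.\<close>
  also have "\<dots> \<le> (\<Sum>k<N. real (h k) * (real H - real (h k)))"
    using max by (intro order.trans[OF sum_image_le]) auto
  finally show ?thesis .
qed

text \<open>
  Selections on a grid: cell \<open>A\<close> starts at time zero and \<open>j i \<le> A + i\<close> is the index selected for
  cell \<open>A + i\<close>. The overlap is the discrete version of the weight \<open>g\<close>.
\<close>

definition overlap :: "nat \<Rightarrow> nat \<Rightarrow> (nat \<Rightarrow> nat) \<Rightarrow> nat \<Rightarrow> nat" where
  "overlap A K j k = card {i. i < K \<and> j i \<le> k \<and> k < A + i}"

lemma overlap_eq_0: "A + K \<le> Suc k \<Longrightarrow> overlap A K j k = 0"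
  unfolding overlap_def by (auto intro!: card_eq_0_iff[THEN iffD2])

lemma overlap_le: "overlap A K j k \<le> K"
proof -
  have "overlap A K j k \<le> card {..<K}"
    unfolding overlap_def by (intro card_mono) auto
  then show ?thesis by simp
qed

text \<open>Moving on from \<open>k\<close> to \<open>Suc k\<close> loses at most the index
  \<open>i\<close> with \<open>A + i = Suc k\<close>, since the condition \<open>j i \<le> k\<close>
  persists. This is the discrete form of slope at least minus one.\<close>

lemma overlap_step: "overlap A K j k \<le> Suc (overlap A K j (Suc k))"
proof -
  have "overlap A K j k \<le> card (insert (Suc k - A) {i. i < K \<and> j i \<le> Suc k \<and> Suc k < A + i})"
    unfolding overlap_def by (intro card_mono) auto
  also have "\<dots> \<le> Suc (card {i. i < K \<and> j i \<le> Suc k \<and> Suc k < A + i})"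
    by (simp add: card_insert_if)
  finally show ?thesis unfolding overlap_def .
qed

text \<open>Each difference telescopes over the indices from \<open>j i\<close> to
  \<open>A + i\<close>; exchanging the sums counts how many of these ranges contain
  \<open>k\<close>. The area thereby becomes a weighted sum of independent increments.\<close>

lemma sum_telescope_overlap:
  fixes f :: "nat \<Rightarrow> real"
  assumes "\<And>i. i < K \<Longrightarrow> j i \<le> A + i"
  shows "(\<Sum>i<K. f (A + i) - f (j i)) = (\<Sum>k<A + K. real (overlap A K j k) * (f (Suc k) - f k))"
proof -
  have "(\<Sum>i<K. f (A + i) - f (j i)) = (\<Sum>i<K. \<Sum>k<A + K. if j i \<le> k \<and> k < A + i then f (Suc k) - f k else 0)"
  proof (rule sum.cong)
    fix i assume i: "i \<in> {..<K}"
    have "(\<Sum>k<A + K. if j i \<le> k \<and> k < A + i then f (Suc k) - f k else 0) = (\<Sum>k\<in>{j i..<A + i}. f (Suc k) - f k)"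
      using i by (intro sum.mono_neutral_cong_right) auto
    also have "\<dots> = f (A + i) - f (j i)"
      using assms i by (intro sum_Suc_diff') auto
    finally show "f (A + i) - f (j i) = (\<Sum>k<A + K. if j i \<le> k \<and> k < A + i then f (Suc k) - f k else 0)" ..
  qed simp
  also have "\<dots> = (\<Sum>k<A + K. \<Sum>i<K. if j i \<le> k \<and> k < A + i then f (Suc k) - f k else 0)"
    by (rule sum.swap)
  also have "\<dots> = (\<Sum>k<A + K. real (overlap A K j k) * (f (Suc k) - f k))"
  proof (rule sum.cong)
    fix k
    have "(\<Sum>i<K. if j i \<le> k \<and> k < A + i then f (Suc k) - f k else 0)
        = (\<Sum>i\<in>{i. i < K \<and> j i \<le> k \<and> k < A + i}. f (Suc k) - f k)"
      by (intro sum.mono_neutral_cong_right) auto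
    then show "(\<Sum>i<K. if j i \<le> k \<and> k < A + i then f (Suc k) - f k else 0)
        = real (overlap A K j k) * (f (Suc k) - f k)"
      by (simp add: overlap_def)
  qed simp
  finally show ?thesis .
qed

text \<open>The constant selection, which attains the rate, has a weight with a plateau of height
  \<open>K\<close> before time zero and a unit-step descent afterwards.\<close>

lemma overlap_0: "overlap A K (\<lambda>_. 0) k = (if k < A then K else A + K - 1 - k)"
proof -
  have "{i. i < K \<and> 0 \<le> k \<and> k < A + i} = (if k < A then {..<K} else {Suc k - A..<K})" by auto
  then show ?thesis by (simp add: overlap_def add.commute)
qed

text \<open>The plateau contributes \<open>f K\<close> once for each of its \<open>A\<close>
  indices, and the descent runs once through every value below \<open>K\<close>.\<close>

lemma sum_overlap_0:
  fixes f :: "nat \<Rightarrow> real"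
  shows "(\<Sum>k<A + K. f (overlap A K (\<lambda>_. 0) k)) = real A * f K + (\<Sum>l<K. f l)"
proof -
  have "(\<Sum>k<A + K. f (overlap A K (\<lambda>_. 0) k))
      = (\<Sum>k<A. f (overlap A K (\<lambda>_. 0) k)) + (\<Sum>l<K. f (overlap A K (\<lambda>_. 0) (A + l)))"
  proof -
    have "(\<Sum>k<A + n. g k) = (\<Sum>k<A. g k) + (\<Sum>l<n. g (A + l))" for n and g :: "nat \<Rightarrow> real"
      by (induction n) (auto simp: add.assoc)
    then show ?thesis .
  qed
  also have "(\<Sum>k<A. f (overlap A K (\<lambda>_. 0) k)) = real A * f K"
    by (simp add: overlap_0)
  also have "(\<Sum>l<K. f (overlap A K (\<lambda>_. 0) (A + l))) = (\<Sum>l<K. f (K - Suc l))"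
    by (simp add: overlap_0)
  also have "\<dots> = (\<Sum>l<K. f l)" by (rule sum.nat_diff_reindex)
  finally show ?thesis .
qed

section \<open>Comparison of the workload area with sums over a grid\<close>

lemma nn_integral_step_function:
  fixes y :: "nat \<Rightarrow> real"
  assumes "e > 0" and [measurable]: "\<And>i. C i \<in> sets lborel" and "\<And>i. emeasure lborel (C i) = ennreal e"
  shows "(\<integral>\<^sup>+ r. (\<Sum>i<K. ennreal (y i) * indicator (C i) r) \<partial>lborel) = (\<Sum>i<K. ennreal e * ennreal (y i))"
  using assms by (subst nn_integral_sum) (auto simp: nn_integral_cmult_indicator mult.commute)

text \<open>The process \<open>B t - c * t\<close> sampled at time \<open>(k - A) * e\<close>. The
  subtraction is in the reals, so indices below \<open>A\<close> are negative times.\<close>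

definition grid_value :: "real \<Rightarrow> (real \<Rightarrow> 'a \<Rightarrow> real) \<Rightarrow> 'a \<Rightarrow> nat \<Rightarrow> real \<Rightarrow> nat \<Rightarrow> real" where
  "grid_value c B \<omega> A e k = B ((real k - real A) * e) \<omega> - c * ((real k - real A) * e)"

text \<open>The supremum is bounded below by the single past time \<open>- (A * e)\<close>.
  Replacing \<open>r\<close> by the left end of its cell costs an oscillation \<open>x\<close> of
  the path and a drift \<open>c * e\<close>.\<close>

lemma workload_area_ge_grid:
  fixes B :: "real \<Rightarrow> 'a \<Rightarrow> real"
  assumes "e > 0" "c \<ge> 0" "real K * e \<le> t"
    and osc: "\<And>k r s. k < A + K \<Longrightarrow> r \<in> {(real k - real A) * e..(real k - real A) * e + e} \<Longrightarrow>
      s \<in> {(real k - real A) * e..(real k - real A) * e + e} \<Longrightarrow> \<bar>B r \<omega> - B s \<omega>\<bar> \<le> x"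
  shows "ennreal (e * (\<Sum>i<K. grid_value c B \<omega> A e (A + i) - grid_value c B \<omega> A e 0 - (x + c * e)))
    \<le> workload_area c B t \<omega>"
proof -
  define y where "y i = grid_value c B \<omega> A e (A + i) - grid_value c B \<omega> A e 0 - (x + c * e)" for i
  \<comment> \<open>Half-open cells are disjoint, so at each time at most one term of the step
    function survives, as a lower bound requires.\<close>
  define C where "C i = {real i * e..<real i * e + e}" for i
  have y_le: "ennreal (y i) \<le> e2ennreal (workload c B r \<omega>)" if "i < K" "r \<in> C i" for i r
  proof -
    have r: "real i * e \<le> r" "r \<le> real i * e + e" using that by (auto simp: C_def)
    have "0 \<le> real i * e" "0 \<le> real A * e" using \<open>e > 0\<close> by auto
    have "\<bar>B r \<omega> - B (real i * e) \<omega>\<bar> \<le> x"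
      using osc[of "A + i" r "real i * e"] r \<open>i < K\<close> \<open>e > 0\<close> by auto
    moreover have "c * r \<le> c * (real i * e + e)" using r \<open>c \<ge> 0\<close> by (intro mult_left_mono) auto
    ultimately have "y i \<le> B r \<omega> - B (- real A * e) \<omega> - c * (r - - real A * e)"
      by (simp add: y_def grid_value_def algebra_simps)
    moreover have "ereal (B r \<omega> - B (- real A * e) \<omega> - c * (r - - real A * e)) \<le> workload c B r \<omega>"
    proof -
      have "- real A * e \<le> r" using r \<open>0 \<le> real i * e\<close> \<open>0 \<le> real A * e\<close> by linarith
      then show ?thesis unfolding workload_def by (intro SUP_upper) auto
    qed
    ultimately have "ereal (y i) \<le> workload c B r \<omega>"
      by (meson ereal_less_eq(3) order.trans)
    from e2ennreal_mono[OF this] show ?thesis by simp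
  qed
  have pointwise: "(\<Sum>i<K. ennreal (y i) * indicator (C i) r) \<le> e2ennreal (workload c B r \<omega>) * indicator {0..t} r" for r
  proof (cases "\<exists>i<K. r \<in> C i")
    case True
    then obtain i where i: "i < K" "r \<in> C i" by blast
    have uniq: "r \<in> C i' \<longleftrightarrow> i' = i" for i'
    proof
      assume that: "r \<in> C i'"
      have "real i * e < (real i' + 1) * e" "real i' * e < (real i + 1) * e"
        using i(2) that by (auto simp: C_def algebra_simps)
      then have "real i < real i' + 1" "real i' < real i + 1" using \<open>e > 0\<close> by auto
      then show "i' = i" by linarith
    qed (use i in simp)
    have "(\<Sum>i<K. ennreal (y i) * indicator (C i) r) = (\<Sum>i'<K. if i' = i then ennreal (y i) else 0)"
      by (intro sum.cong) (auto simp: indicator_def uniq)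
    also have "\<dots> = ennreal (y i)" using i by simp
    also have "\<dots> \<le> e2ennreal (workload c B r \<omega>)" using y_le i by simp
    also have "\<dots> = e2ennreal (workload c B r \<omega>) * indicator {0..t} r"
    proof -
      have "real (Suc i) * e \<le> real K * e" using i \<open>e > 0\<close> by (intro mult_right_mono of_nat_mono) auto
      moreover have "0 \<le> real i * e" using \<open>e > 0\<close> by simp
      moreover have "real i * e \<le> r" "r < real i * e + e" using i(2) by (simp_all add: C_def)
      moreover have "real (Suc i) * e = real i * e + e" by (simp add: algebra_simps)
      ultimately have "0 \<le> r" "r \<le> t" using \<open>real K * e \<le> t\<close> by linarith+
      then have "r \<in> {0..t}" by simp
      then show ?thesis by simp
    qed
    finally show ?thesis .
  next
    case False
    then have "(\<Sum>i<K. ennreal (y i) * indicator (C i) r) = 0" by (auto simp: indicator_def)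
    then show ?thesis by simp
  qed
  \<comment> \<open>\<open>ennreal\<close> truncates negative terms to zero, so the sum is first
    enlarged to positive parts and only then split.\<close>
  have "ennreal (e * (\<Sum>i<K. y i)) \<le> ennreal (\<Sum>i<K. e * max 0 (y i))"
    unfolding sum_distrib_left using \<open>e > 0\<close> by (intro ennreal_leI sum_mono mult_left_mono) auto
  also have "\<dots> = (\<Sum>i<K. ennreal e * ennreal (y i))"
    using \<open>e > 0\<close> by (subst sum_ennreal[symmetric]) (auto simp: ennreal_mult' max_def ennreal_neg intro!: sum.cong)
  also have "\<dots> = (\<integral>\<^sup>+ r. (\<Sum>i<K. ennreal (y i) * indicator (C i) r) \<partial>lborel)"
    using \<open>e > 0\<close> by (intro nn_integral_step_function[symmetric]) (auto simp: C_def)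
  also have "\<dots> \<le> workload_area c B t \<omega>"
    unfolding workload_area_def by (intro nn_integral_mono pointwise)
  finally show ?thesis unfolding y_def .
qed

text \<open>Once the remote past is excluded, every \<open>s\<close> shares a cell with a grid time,
  and the supremum over \<open>s\<close> becomes a maximum over grid indices, up to an oscillation
  \<open>x\<close> at each of \<open>r\<close> and \<open>s\<close> and a drift
  \<open>c * e\<close>. The maximisers form \<open>j\<close>, taken extensional so that it ranges
  over a finite set.\<close>

lemma workload_area_le_grid:
  fixes B :: "real \<Rightarrow> 'a \<Rightarrow> real"
  assumes "e > 0" "c \<ge> 0" "K > 0"
    and osc: "\<And>k r s. k < A + K \<Longrightarrow> r \<in> {(real k - real A) * e..(real k - real A) * e + e} \<Longrightarrow>
      s \<in> {(real k - real A) * e..(real k - real A) * e + e} \<Longrightarrow> \<bar>B r \<omega> - B s \<omega>\<bar> \<le> x"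
    and past: "\<And>s. s \<le> - (real A * e) \<Longrightarrow> B 0 \<omega> - B s \<omega> + c * s \<le> 0"
  obtains j where "j \<in> (\<Pi>\<^sub>E i\<in>{..<K}. {..A + i})"
    "workload_area c B (real K * e) \<omega>
      \<le> ennreal (e * (\<Sum>i<K. grid_value c B \<omega> A e (A + i) - grid_value c B \<omega> A e (j i) + (2 * x + c * e)))"
proof -
  let ?g = "grid_value c B \<omega> A e"
  have "\<exists>k\<in>{..A + i}. \<forall>k'\<in>{..A + i}. ?g (A + i) - ?g k' \<le> ?g (A + i) - ?g k" for i
  proof -
    have "Max ((\<lambda>k. ?g (A + i) - ?g k) ` {..A + i}) \<in> (\<lambda>k. ?g (A + i) - ?g k) ` {..A + i}"
      by (intro Max_in) auto
    then obtain k where k: "k \<in> {..A + i}" "Max ((\<lambda>k. ?g (A + i) - ?g k) ` {..A + i}) = ?g (A + i) - ?g k"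
      by blast
    moreover have "\<forall>k'\<in>{..A + i}. ?g (A + i) - ?g k' \<le> Max ((\<lambda>k. ?g (A + i) - ?g k) ` {..A + i})"
      by auto
    ultimately show ?thesis by metis
  qed
  then obtain j where j: "\<And>i. j i \<le> A + i" "\<And>i k. k \<le> A + i \<Longrightarrow> ?g (A + i) - ?g k \<le> ?g (A + i) - ?g (j i)"
    unfolding Bex_def Ball_def atMost_iff by metis
  define y where "y i = ?g (A + i) - ?g (j i) + (2 * x + c * e)" for i
  \<comment> \<open>Closed cells cover the right end of the interval too; overlapping endpoints only
    enlarge the step function, which is harmless in an upper bound.\<close>
  define C where "C i = {real i * e..real i * e + e}" for i
  have cell: "B r \<omega> - B s \<omega> - c * (r - s) \<le> y i"
    if "i < K" "r \<in> C i" "- (real A * e) \<le> s" "s \<le> r" for i r s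
  proof -
    \<comment> \<open>The cell of \<open>s\<close>, capped at \<open>A + i\<close>: if
      \<open>s = r\<close> is the right end of its closed cell, rounding down would give the next
      index.\<close>
    define k where "k = min (A + i) (nat \<lfloor>s / e + real A\<rfloor>)"
    have r: "real i * e \<le> r" "r \<le> real i * e + e" using that by (auto simp: C_def)
    have nonneg: "0 \<le> s / e + real A" using that \<open>e > 0\<close> by (simp add: field_simps)
    have "real k \<le> s / e + real A"
      using nonneg unfolding k_def by (simp add: min_def) linarith
    then have ks: "(real k - real A) * e \<le> s" using \<open>e > 0\<close> by (simp add: field_simps)
    have sk: "s \<le> (real k - real A) * e + e"
    proof (cases "nat \<lfloor>s / e + real A\<rfloor> \<le> A + i")
      case True
      then have "s / e + real A \<le> real k + 1" using nonneg unfolding k_def by (simp add: min_def) linarith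
      then show ?thesis using \<open>e > 0\<close> by (simp add: field_simps)
    next
      case False
      then have "k = A + i" by (simp add: k_def)
      then show ?thesis using r that by simp
    qed
    have "k \<le> A + i" by (simp add: k_def)
    have "\<bar>B r \<omega> - B (real i * e) \<omega>\<bar> \<le> x"
      using osc[of "A + i" r "real i * e"] r \<open>i < K\<close> \<open>e > 0\<close> by auto
    moreover have "\<bar>B s \<omega> - B ((real k - real A) * e) \<omega>\<bar> \<le> x"
      using osc[of k s "(real k - real A) * e"] ks sk \<open>k \<le> A + i\<close> \<open>i < K\<close> \<open>e > 0\<close> by auto
    moreover have "c * (real i * e - ((real k - real A) * e + e)) \<le> c * (r - s)"
      using r sk \<open>c \<ge> 0\<close> by (intro mult_left_mono) auto
    ultimately have "B r \<omega> - B s \<omega> - c * (r - s) \<le> ?g (A + i) - ?g k + (2 * x + c * e)"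
      by (simp add: grid_value_def algebra_simps)
    then show ?thesis using j(2)[OF \<open>k \<le> A + i\<close>] by (simp add: y_def)
  qed
  have le_y: "e2ennreal (workload c B r \<omega>) \<le> ennreal (y i)" if "i < K" "r \<in> C i" for i r
  proof -
    have "0 \<le> real i * e" "0 \<le> real A * e" using \<open>e > 0\<close> by auto
    moreover have "real i * e \<le> r" using that by (simp add: C_def)
    ultimately have "0 \<le> r" by linarith
    have "workload c B r \<omega> \<le> ereal (y i)"
      unfolding workload_def
    proof (rule SUP_least)
      fix s assume s: "s \<in> {..r}"
      show "ereal (B r \<omega> - B s \<omega> - c * (r - s)) \<le> ereal (y i)"
      proof (cases "- (real A * e) \<le> s")
        case True
        then show ?thesis using cell[OF that] s by simp
      next
        case False
        \<comment> \<open>Beyond the grid \<open>s\<close> is no better than time zero, because the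
          quantity splits into its value at time zero plus
          \<open>B 0 \<omega> - B s \<omega> + c * s\<close>.\<close>
        then have "B 0 \<omega> - B s \<omega> + c * s \<le> 0" using past[of s] by simp
        moreover have "B r \<omega> - B 0 \<omega> - c * (r - 0) \<le> y i"
          using \<open>0 \<le> r\<close> \<open>e > 0\<close> by (intro cell[OF that]) auto
        ultimately show ?thesis by (simp add: algebra_simps)
      qed
    qed
    from e2ennreal_mono[OF this] show ?thesis by simp
  qed
  have y_nonneg: "0 \<le> y i" if "i < K" for i
  proof -
    have "0 \<le> x" using osc[of "A + i" "real i * e" "real i * e"] that \<open>e > 0\<close> by simp
    then show ?thesis using j(2)[of "A + i" i] \<open>c \<ge> 0\<close> \<open>e > 0\<close> by (simp add: y_def)
  qed
  have pointwise: "e2ennreal (workload c B r \<omega>) * indicator {0..real K * e} r \<le> (\<Sum>i<K. ennreal (y i) * indicator (C i) r)" for r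
  proof (cases "r \<in> {0..real K * e}")
    case True
    \<comment> \<open>The cap puts the right end of the interval into the last cell.\<close>
    define i where "i = min (K - 1) (nat \<lfloor>r / e\<rfloor>)"
    have nonneg: "0 \<le> r / e" using True \<open>e > 0\<close> by simp
    have "i < K" using \<open>K > 0\<close> by (auto simp: i_def)
    have "real i \<le> r / e" using nonneg unfolding i_def by (simp add: min_def) linarith
    moreover have "r / e \<le> real i + 1"
    proof (cases "nat \<lfloor>r / e\<rfloor> \<le> K - 1")
      case True
      then have "i = nat \<lfloor>r / e\<rfloor>" by (simp add: i_def)
      then show ?thesis by linarith
    next
      case False
      then have "real i + 1 = real K" using \<open>i < K\<close> by (simp add: i_def)
      moreover have "r \<le> real K * e" using \<open>r \<in> {0..real K * e}\<close> by simp
      ultimately show ?thesis using \<open>e > 0\<close> by (simp add: divide_le_eq)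
    qed
    ultimately have "r \<in> C i" using \<open>e > 0\<close> by (simp add: C_def field_simps)
    then have "e2ennreal (workload c B r \<omega>) * indicator {0..real K * e} r \<le> ennreal (y i) * indicator (C i) r"
      using le_y \<open>i < K\<close> True by simp
    also have "\<dots> \<le> (\<Sum>i<K. ennreal (y i) * indicator (C i) r)"
      using \<open>i < K\<close> by (intro member_le_sum[where f="\<lambda>i. ennreal (y i) * indicator (C i) r"]) auto
    finally show ?thesis .
  next
    case False
    then show ?thesis by (auto simp: indicator_def)
  qed
  show ?thesis
  proof (rule that)
    show "restrict j {..<K} \<in> (\<Pi>\<^sub>E i\<in>{..<K}. {..A + i})" by (simp add: restrict_PiE_iff j(1))
    have "workload_area c B (real K * e) \<omega> \<le> (\<integral>\<^sup>+ r. (\<Sum>i<K. ennreal (y i) * indicator (C i) r) \<partial>lborel)"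
      unfolding workload_area_def by (intro nn_integral_mono pointwise)
    also have "\<dots> = (\<Sum>i<K. ennreal e * ennreal (y i))"
      using \<open>e > 0\<close> by (intro nn_integral_step_function) (auto simp: C_def)
    also have "\<dots> = (\<Sum>i<K. ennreal (e * y i))"
      using \<open>e > 0\<close> y_nonneg by (intro sum.cong) (auto simp: ennreal_mult)
    also have "\<dots> = ennreal (e * (\<Sum>i<K. y i))"
      unfolding sum_distrib_left using \<open>e > 0\<close> y_nonneg by (intro sum_ennreal) auto
    finally show "workload_area c B (real K * e) \<omega>
        \<le> ennreal (e * (\<Sum>i<K. ?g (A + i) - ?g (restrict j {..<K} i) + (2 * x + c * e)))"
      by (simp add: y_def)
  qed
qed

text \<open>Separates the centred Gaussian part from the deterministic drift, for which the sum of
  the overlaps is the total length of the selected intervals in cells.\<close>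

lemma sum_grid_value:
  assumes "\<And>i. i < K \<Longrightarrow> j i \<le> A + i"
  shows "(\<Sum>i<K. grid_value c B \<omega> A e (A + i) - grid_value c B \<omega> A e (j i))
    = (\<Sum>k<A + K. real (overlap A K j k) *
        (B (- (real A * e) + real (Suc k) * e) \<omega> - B (- (real A * e) + real k * e) \<omega>))
      - c * e * (\<Sum>k<A + K. real (overlap A K j k))"
proof -
  let ?g = "grid_value c B \<omega> A e"
  have "(\<Sum>i<K. ?g (A + i) - ?g (j i)) = (\<Sum>k<A + K. real (overlap A K j k) * (?g (Suc k) - ?g k))"
    by (rule sum_telescope_overlap) fact
  also have "\<dots> = (\<Sum>k<A + K. real (overlap A K j k) *
        (B (- (real A * e) + real (Suc k) * e) \<omega> - B (- (real A * e) + real k * e) \<omega>)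
        - c * e * real (overlap A K j k))"
    by (intro sum.cong) (auto simp: grid_value_def algebra_simps)
  finally show ?thesis by (simp add: sum_subtractf sum_distrib_left)
qed

section \<open>Path properties of Brownian motion\<close>

text \<open>A dyadic point of level \<open>Suc m\<close> is either of level \<open>m\<close> or one
  increment to the right of such a point, so the geometric bounds add up to \<open>4 * y\<close>;
  continuity extends this to all times. The ratio \<open>3 / 4\<close> exceeds
  \<open>1 / sqrt 2\<close>, which keeps Gaussian tails summable over the levels.\<close>

lemma dyadic_chaining:
  fixes f :: "real \<Rightarrow> real"
  assumes cont: "continuous_on UNIV f" and "b > 0" "y \<ge> 0"
    and inc: "\<And>m k :: nat. k < 2 ^ m \<Longrightarrow>
      \<bar>f (a + real (Suc k) * b / 2 ^ m) - f (a + real k * b / 2 ^ m)\<bar> \<le> y * (3 / 4) ^ m"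
    and t: "t \<in> {a..a + b}"
  shows "\<bar>f t - f a\<bar> \<le> 4 * y"
proof -
  \<comment> \<open>The bound is the partial sum of \<open>y * (3 / 4) ^ i\<close> over
    \<open>i \<le> m\<close>.\<close>
  have dyadic: "\<bar>f (a + real k * b / 2 ^ m) - f a\<bar> \<le> 4 * y * (1 - (3 / 4) ^ Suc m)" if "k \<le> 2 ^ m" for m k :: nat
    using that
  proof (induction m arbitrary: k)
    case 0
    then have "k = 0 \<or> k = 1" by auto
    then show ?case using inc[of 0 0] \<open>y \<ge> 0\<close> by auto
  next
    case (Suc m)
    have step: "4 * y * (1 - (3 / 4) ^ Suc m) + y * (3 / 4) ^ Suc m = 4 * y * (1 - (3 / 4) ^ Suc (Suc m))"
      by (simp add: algebra_simps)
    have nonneg: "0 \<le> y * (3 / 4) ^ Suc m" using \<open>y \<ge> 0\<close> by simp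
    define j where "j = k div 2"
    have j: "real (2 * j) * b / 2 ^ Suc m = real j * b / 2 ^ m" by simp
    show ?case
    proof (cases "even k")
      case True
      then have k: "k = 2 * j" by (simp add: j_def)
      then have "\<bar>f (a + real j * b / 2 ^ m) - f a\<bar> \<le> 4 * y * (1 - (3 / 4) ^ Suc m)"
        using Suc by auto
      then show ?thesis using step nonneg unfolding k j by linarith
    next
      case False
      then have k: "k = Suc (2 * j)" by (simp add: j_def)
      then have "\<bar>f (a + real j * b / 2 ^ m) - f a\<bar> \<le> 4 * y * (1 - (3 / 4) ^ Suc m)"
        using Suc by auto
      moreover have "\<bar>f (a + real k * b / 2 ^ Suc m) - f (a + real j * b / 2 ^ m)\<bar> \<le> y * (3 / 4) ^ Suc m"
        using inc[of "2 * j" "Suc m"] Suc.prems unfolding k j by simp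
      ultimately show ?thesis using step by linarith
    qed
  qed
  \<comment> \<open>Dyadic approximation of \<open>t\<close> from below.\<close>
  define k where "k m = nat \<lfloor>(t - a) * 2 ^ m / b\<rfloor>" for m
  have k: "real (k m) \<le> (t - a) * 2 ^ m / b" "(t - a) * 2 ^ m / b < real (k m) + 1" for m
    using t \<open>b > 0\<close> unfolding k_def by (simp_all add: floor_correct)
  have k_le: "k m \<le> 2 ^ m" for m
  proof -
    have "(t - a) * 2 ^ m / b \<le> b * 2 ^ m / b"
      using t \<open>b > 0\<close> by (intro divide_right_mono mult_right_mono) auto
    then have "(t - a) * 2 ^ m / b \<le> 2 ^ m" using \<open>b > 0\<close> by simp
    then have "real (k m) \<le> 2 ^ m" using k(1)[of m] by linarith
    then show ?thesis by simp
  qed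
  have "(\<lambda>m. a + real (k m) * b / 2 ^ m) \<longlonglongrightarrow> t"
  proof (rule LIM_zero_cancel, rule Lim_null_comparison)
    show "(\<lambda>m. b * (1 / 2) ^ m) \<longlonglongrightarrow> 0"
      by (intro tendsto_mult_right_zero LIMSEQ_power_zero) auto
    have "\<bar>a + real (k m) * b / 2 ^ m - t\<bar> \<le> b * (1 / 2) ^ m" for m
    proof -
      have "real (k m) * b / 2 ^ m \<le> t - a" "t - a \<le> real (k m) * b / 2 ^ m + b / 2 ^ m"
        using k[of m] \<open>b > 0\<close> by (auto simp: field_simps)
      then show ?thesis by (simp add: power_one_over)
    qed
    then show "\<forall>\<^sub>F m in sequentially. norm (a + real (k m) * b / 2 ^ m - t) \<le> b * (1 / 2) ^ m"
      by simp
  qed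
  then have "(\<lambda>m. f (a + real (k m) * b / 2 ^ m)) \<longlonglongrightarrow> f t"
    using cont by (auto intro: continuous_on_tendsto_compose[where f=f and s=UNIV])
  then have "(\<lambda>m. \<bar>f (a + real (k m) * b / 2 ^ m) - f a\<bar>) \<longlonglongrightarrow> \<bar>f t - f a\<bar>"
    by (intro tendsto_intros)
  moreover have "\<bar>f (a + real (k m) * b / 2 ^ m) - f a\<bar> \<le> 4 * y" for m
  proof -
    have "4 * y * (1 - (3 / 4) ^ Suc m) \<le> 4 * y"
      using \<open>y \<ge> 0\<close> by (intro mult_left_le) auto
    then show ?thesis using dyadic[OF k_le] order.trans by blast
  qed
  ultimately show ?thesis by (intro LIMSEQ_le_const2) auto
qed

lemma (in prob_space) prob_UN_geometric:
  assumes "\<And>i :: nat. A i \<in> events" "\<And>i. prob (A i) \<le> C * q ^ i" "0 \<le> q" "q < 1"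
  shows "prob (\<Union>i. A i) \<le> C / (1 - q)"
proof -
  have sums: "(\<lambda>i. C * q ^ i) sums (C * (1 / (1 - q)))"
    using assms by (intro sums_mult geometric_sums) auto
  have summable: "summable (\<lambda>i. prob (A i))"
    using assms by (intro summable_comparison_test'[OF sums_summable[OF sums]]) auto
  then have "prob (\<Union>i. A i) \<le> (\<Sum>i. prob (A i))"
    using assms by (intro finite_measure_subadditive_countably) auto
  also have "\<dots> \<le> (\<Sum>i. C * q ^ i)"
    using assms by (intro suminf_le summable sums_summable[OF sums])
  finally show ?thesis using sums_unique[OF sums] by simp
qed

context two_sided_brownian_motion
begin

declare random_variable_B [measurable]

lemma increment_tail:
  assumes "b > 0" "y \<ge> 0"
  shows "prob {\<omega> \<in> space M. \<bar>B (a + b) \<omega> - B a \<omega>\<bar> > y} \<le> 2 * exp (- (y\<^sup>2 / (2 * b)))"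
  using normal_tail_abs[OF normal_increments[of a "a + b"], of y] assms by simp

text \<open>Level \<open>m\<close> has \<open>2 ^ m\<close> increments of variance
  \<open>b / 2 ^ m\<close>; each exceeds its bound with probability at most
  \<open>2 * exp (- (z * (9 / 8) ^ m))\<close>, where \<open>9 / 8 = 2 * (3 / 4)^2\<close>.
  Returning an exceptional event avoids the measurability of the oscillation itself.\<close>

lemma oscillation_tail:
  assumes "b > 0" "x > 0" "x\<^sup>2 / (128 * b) \<ge> 16"
  obtains N where "N \<in> events" "prob N \<le> 4 * exp (- (x\<^sup>2 / (128 * b)))"
    "\<And>\<omega> s t. \<omega> \<in> space M - N \<Longrightarrow> s \<in> {a..a + b} \<Longrightarrow> t \<in> {a..a + b} \<Longrightarrow> \<bar>B t \<omega> - B s \<omega>\<bar> \<le> x"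
proof -
  \<comment> \<open>Chaining gives \<open>4 * y\<close> between \<open>a\<close> and each of the two
    times, hence \<open>8 * y = x\<close> in total; \<open>z\<close> is then
    \<open>y^2 / (2 * b)\<close>.\<close>
  define y z where "y = x / 8" and "z = x\<^sup>2 / (128 * b)"
  have y: "y > 0" and z: "z \<ge> 16" using assms by (auto simp: y_def z_def)
  define E where "E m k = {\<omega> \<in> space M.
      \<bar>B (a + real (Suc k) * b / 2 ^ m) \<omega> - B (a + real k * b / 2 ^ m) \<omega>\<bar> > y * (3 / 4) ^ m}" for m k :: nat
  have E [measurable]: "E m k \<in> events" for m k
    unfolding E_def by measurable
  have prob_E: "prob (E m k) \<le> 2 * exp (- (z * (9 / 8) ^ m))" for m k
  proof -
    have "(y * (3 / 4) ^ m)\<^sup>2 / (2 * (b / 2 ^ m)) = z * (((3 / 4) ^ m)\<^sup>2 * 2 ^ m)"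
      using \<open>b > 0\<close> by (simp add: y_def z_def power2_eq_square field_simps)
    also have "((3 / 4) ^ m)\<^sup>2 * 2 ^ m = (9 / 8 :: real) ^ m"
      by (simp add: power2_eq_square flip: power_mult_distrib)
    finally have "(y * (3 / 4) ^ m)\<^sup>2 / (2 * (b / 2 ^ m)) = z * (9 / 8) ^ m" .
    moreover have "a + real (Suc k) * b / 2 ^ m = a + real k * b / 2 ^ m + b / 2 ^ m"
      by (simp add: field_simps)
    ultimately show ?thesis
      using increment_tail[of "b / 2 ^ m" "y * (3 / 4) ^ m" "a + real k * b / 2 ^ m"] \<open>b > 0\<close> y
      by (simp add: E_def add.assoc)
  qed
  have prob_UN_E: "prob (\<Union>k<2 ^ m. E m k) \<le> 2 * exp (- z) * (1 / 2) ^ m" for m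
  proof -
    have "prob (\<Union>k<2 ^ m. E m k) \<le> (\<Sum>k<2 ^ m. prob (E m k))"
      by (intro finite_measure_subadditive_finite) auto
    also have "\<dots> \<le> 2 ^ m * (2 * exp (- (z * (9 / 8) ^ m)))"
      using sum_bounded_above[of "{..<2 ^ m}" "\<lambda>k. prob (E m k)"] prob_E by force
    \<comment> \<open>Bernoulli's inequality and \<open>z \<ge> 16\<close> turn the exponent into
      \<open>z + 2 * m\<close>, which outweighs the \<open>2 ^ m\<close> terms of the level.\<close>
    also have "\<dots> \<le> 2 ^ m * (2 * exp (- z - 2 * real m))"
    proof -
      have "1 + real m * (1 / 8) \<le> (1 + 1 / 8) ^ m"
        by (rule Bernoulli_inequality) simp
      then have "z * (1 + real m / 8) \<le> z * (9 / 8) ^ m" using z by (intro mult_left_mono) auto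
      moreover have "16 * real m \<le> z * real m" using z by (intro mult_right_mono) auto
      ultimately show ?thesis by (simp add: algebra_simps)
    qed
    also have "\<dots> = 2 * exp (- z) * (2 * exp (- 2)) ^ m"
      by (simp add: exp_diff exp_minus exp_of_nat_mult[symmetric] field_simps)
    also have "\<dots> \<le> 2 * exp (- z) * (1 / 2) ^ m"
    proof (intro mult_left_mono power_mono)
      have "(2 :: real)\<^sup>2 \<le> (exp 1)\<^sup>2"
        using exp_ge_add_one_self[of 1] by (intro power_mono) auto
      also have "\<dots> = exp (2 :: real)" by (simp add: exp_double[symmetric])
      finally show "2 * exp (- 2) \<le> 1 / (2 :: real)" by (simp add: exp_minus field_simps)
    qed auto
    finally show ?thesis .
  qed
  show ?thesis
  proof (rule that)
    show "(\<Union>m. \<Union>k<2 ^ m. E m k) \<in> events" by measurable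
    have "prob (\<Union>m. \<Union>k<2 ^ m. E m k) \<le> 2 * exp (- z) / (1 - 1 / 2)"
      by (rule prob_UN_geometric[OF _ prob_UN_E]) auto
    then show "prob (\<Union>m. \<Union>k<2 ^ m. E m k) \<le> 4 * exp (- (x\<^sup>2 / (128 * b)))"
      by (simp add: z_def)
  next
    fix \<omega> s t
    assume \<omega>: "\<omega> \<in> space M - (\<Union>m. \<Union>k<2 ^ m. E m k)" and st: "s \<in> {a..a + b}" "t \<in> {a..a + b}"
    have "\<bar>B t \<omega> - B a \<omega>\<bar> \<le> 4 * y" if "t \<in> {a..a + b}" for t
    proof (rule dyadic_chaining[OF continuous_paths \<open>b > 0\<close> _ _ that])
      show "\<bar>B (a + real (Suc k) * b / 2 ^ m) \<omega> - B (a + real k * b / 2 ^ m) \<omega>\<bar> \<le> y * (3 / 4) ^ m"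
        if "k < 2 ^ m" for m k
        using \<omega> that unfolding E_def by (auto simp: not_less)
    qed (use \<omega> y in auto)
    from this[OF st(1)] this[OF st(2)] show "\<bar>B t \<omega> - B s \<omega>\<bar> \<le> x"
      unfolding y_def by linarith
  qed
qed

text \<open>The past is covered by blocks \<open>b l / 2 \<le> - s < b l\<close> of doubling length.
  An oscillation of at most \<open>c * b l / 2\<close> on \<open>[- b l, 0]\<close> is dominated by
  the drift \<open>c * (- s)\<close> there, and the failure exponents \<open>w * 2 ^ l\<close> are
  summable.\<close>

lemma remote_past_tail:
  assumes "c > 0" "L > 0" and w: "c\<^sup>2 * L / 256 \<ge> 16"
  obtains N where "N \<in> events" "prob N \<le> 8 * exp (- (c\<^sup>2 * L / 256))"
    "\<And>\<omega> s. \<omega> \<in> space M - N \<Longrightarrow> s \<le> - L \<Longrightarrow> - B s \<omega> + c * s \<le> 0"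
proof -
  define w where "w = c\<^sup>2 * L / 256"
  have "w \<ge> 16" using w by (simp add: w_def)
  define b where "b l = 2 ^ Suc l * L" for l :: nat
  have b: "b l > 0" for l using \<open>L > 0\<close> by (simp add: b_def)
  have z: "(c * b l / 2)\<^sup>2 / (128 * b l) = w * 2 ^ l" for l
    using \<open>L > 0\<close> by (simp add: b_def w_def power2_eq_square field_simps)
  define P where "P l N \<longleftrightarrow> N \<in> events \<and> prob N \<le> 4 * exp (- (w * 2 ^ l)) \<and> (\<forall>\<omega> s t.
      \<omega> \<in> space M - N \<longrightarrow> s \<in> {- b l..0} \<longrightarrow> t \<in> {- b l..0} \<longrightarrow> \<bar>B t \<omega> - B s \<omega>\<bar> \<le> c * b l / 2)" for l N
  have "\<exists>N. P l N" for l
  proof -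
    have "1 * 16 \<le> 2 ^ l * w" using \<open>w \<ge> 16\<close> by (intro mult_mono) auto
    then have "(c * b l / 2)\<^sup>2 / (128 * b l) \<ge> 16" unfolding z by (simp add: mult.commute)
    then obtain N where "N \<in> events" "prob N \<le> 4 * exp (- ((c * b l / 2)\<^sup>2 / (128 * b l)))"
      "\<And>\<omega> s t. \<omega> \<in> space M - N \<Longrightarrow> s \<in> {- b l..- b l + b l} \<Longrightarrow> t \<in> {- b l..- b l + b l} \<Longrightarrow>
        \<bar>B t \<omega> - B s \<omega>\<bar> \<le> c * b l / 2"
      using oscillation_tail[of "b l" "c * b l / 2" "- b l"] b[of l] \<open>c > 0\<close> by auto
    then have "P l N" unfolding P_def z by simp
    then show ?thesis ..
  qed
  then obtain N where "\<And>l. P l (N l)" by metis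
  then have N: "\<And>l. N l \<in> events" "\<And>l. prob (N l) \<le> 4 * exp (- (w * 2 ^ l))"
    "\<And>l \<omega> s t. \<omega> \<in> space M - N l \<Longrightarrow> s \<in> {- b l..0} \<Longrightarrow> t \<in> {- b l..0} \<Longrightarrow> \<bar>B t \<omega> - B s \<omega>\<bar> \<le> c * b l / 2"
    unfolding P_def by blast+
  have prob_N: "prob (N l) \<le> 4 * exp (- w) * (1 / 2) ^ l" for l
  proof -
    have "1 + real l * 1 \<le> (1 + 1) ^ l"
      by (rule Bernoulli_inequality) simp
    then have "w * (1 + real l) \<le> w * 2 ^ l" using \<open>w \<ge> 16\<close> by (intro mult_left_mono) auto
    then have "exp (- (w * 2 ^ l)) \<le> exp (- w - w * real l)" by (simp add: algebra_simps)
    also have "\<dots> = exp (- w) * exp (- w) ^ l"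
      by (simp add: exp_diff exp_minus exp_of_nat_mult[symmetric] field_simps)
    also have "\<dots> \<le> exp (- w) * (1 / 2) ^ l"
    proof (intro mult_left_mono power_mono)
      show "exp (- w) \<le> 1 / 2"
        using order.trans[OF _ exp_ge_add_one_self[of w], of 2] \<open>w \<ge> 16\<close>
        by (simp add: exp_minus field_simps)
    qed auto
    finally show ?thesis using N(2)[of l] by simp
  qed
  show ?thesis
  proof (rule that)
    show "(\<Union>l. N l) \<in> events" using N(1) by auto
    show "prob (\<Union>l. N l) \<le> 8 * exp (- (c\<^sup>2 * L / 256))"
      using prob_UN_geometric[OF N(1) prob_N] by (simp add: w_def)
  next
    fix \<omega> s assume \<omega>: "\<omega> \<in> space M - (\<Union>l. N l)" and s: "s \<le> - L"
    have "1 \<le> nat \<lfloor>- s / L\<rfloor>" using s \<open>L > 0\<close> by (simp add: le_nat_iff le_floor_iff field_simps)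
    \<comment> \<open>The block of \<open>s\<close> is found from the binary exponent of
      \<open>- s / L\<close>.\<close>
    then obtain l where l: "2 ^ l \<le> nat \<lfloor>- s / L\<rfloor>" "nat \<lfloor>- s / L\<rfloor> < 2 ^ (l + 1)"
      using ex_power_ivl1[of 2 "nat \<lfloor>- s / L\<rfloor>"] by auto
    have "2 ^ l \<le> - s / L" 
      using l(1) s \<open>L > 0\<close> by (simp add: le_nat_iff le_floor_iff)
    moreover have "- s / L < 2 ^ (l + 1)"
    proof -
      have "real (Suc (nat \<lfloor>- s / L\<rfloor>)) \<le> real (2 ^ (l + 1))" using l(2) by (intro of_nat_mono) simp
      then have "real (nat \<lfloor>- s / L\<rfloor>) + 1 \<le> 2 ^ (l + 1)" by simp
      then show ?thesis by linarith
    qed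
    ultimately have s': "b l / 2 \<le> - s" "- s < b l"
      using \<open>L > 0\<close> by (auto simp: b_def field_simps)
    then have "\<bar>B 0 \<omega> - B s \<omega>\<bar> \<le> c * b l / 2"
      using N(3)[of \<omega> l s 0] \<omega> s \<open>L > 0\<close> b[of l] by auto
    moreover have "c * (b l / 2) \<le> c * (- s)"
      using s' \<open>c > 0\<close> by (intro mult_left_mono) auto
    ultimately show "- B s \<omega> + c * s \<le> 0" using \<omega> B_zero by auto
  qed
qed

lemma normal_weighted_increments:
  fixes h :: "nat \<Rightarrow> real"
  assumes "e > 0" and nz: "\<exists>k<N. h k \<noteq> 0"
  shows "distributed M lborel (\<lambda>\<omega>. \<Sum>k<N. h k * (B (a + real (Suc k) * e) \<omega> - B (a + real k * e) \<omega>))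
    (normal_density 0 (sqrt (e * (\<Sum>k<N. (h k)\<^sup>2))))"
proof -
  \<comment> \<open>A term of weight zero has no density, so the normal sum is formed over the
    support of the weights only; \<open>nz\<close> makes it nonempty.\<close>
  define I where "I = {k. k < N \<and> h k \<noteq> 0}"
  let ?X = "\<lambda>k \<omega>. h k * (B (a + real (Suc k) * e) \<omega> - B (a + real k * e) \<omega>)"
  have "indep_vars (\<lambda>_. borel) (\<lambda>k \<omega>. B (a + real (Suc k) * e) \<omega> - B (a + real k * e) \<omega>) {..<N}"
    using independent_increments[of N "\<lambda>k. a + real k * e"] \<open>e > 0\<close>
    by (auto simp: strict_mono_on_def)
  then have "indep_vars (\<lambda>_. borel) (\<lambda>k \<omega>. B (a + real (Suc k) * e) \<omega> - B (a + real k * e) \<omega>) I"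
    by (rule indep_vars_subset) (auto simp: I_def)
  then have "indep_vars (\<lambda>_. borel) ?X I"
    by (rule indep_vars_compose2) simp
  moreover have "distributed M lborel (?X k) (normal_density 0 (\<bar>h k\<bar> * sqrt e))" if "k \<in> I" for k
    using normal_density_affine[OF normal_increments[of "a + real k * e" "a + real (Suc k) * e"], of "h k" 0]
      that \<open>e > 0\<close> by (simp add: I_def algebra_simps)
  ultimately have "distributed M lborel (\<lambda>\<omega>. \<Sum>k\<in>I. ?X k \<omega>)
      (normal_density (\<Sum>k\<in>I. 0) (sqrt (\<Sum>k\<in>I. (\<bar>h k\<bar> * sqrt e)\<^sup>2)))"
    using nz \<open>e > 0\<close> by (intro sum_indep_normal) (auto simp: I_def)
  moreover have "(\<lambda>\<omega>. \<Sum>k\<in>I. ?X k \<omega>) = (\<lambda>\<omega>. \<Sum>k<N. ?X k \<omega>)"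
    by (intro ext sum.mono_neutral_left) (auto simp: I_def)
  moreover have "(\<Sum>k\<in>I. (\<bar>h k\<bar> * sqrt e)\<^sup>2) = (\<Sum>k<N. (\<bar>h k\<bar> * sqrt e)\<^sup>2)"
    by (intro sum.mono_neutral_left) (auto simp: I_def)
  ultimately show ?thesis
    using \<open>e > 0\<close> by (simp add: power_mult_distrib sum_distrib_left mult.commute)
qed

section \<open>Joint measurability in outcome and time, and measurability of the area\<close>

lemma measurable_B_pair: "(\<lambda>(\<omega>, t). B (t + s) \<omega>) \<in> borel_measurable (M \<Otimes>\<^sub>M borel)"
proof (rule borel_measurable_LIMSEQ_real)
  \<comment> \<open>Rounding the time down to multiples of \<open>1 / Suc k\<close> leaves countably
    many random variables to select from; path continuity identifies the limit.\<close>
  let ?u = "\<lambda>k (\<omega>, t). B (of_int \<lfloor>real (Suc k) * (t + s)\<rfloor> / real (Suc k)) \<omega>"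
  show "?u k \<in> borel_measurable (M \<Otimes>\<^sub>M borel)" for k
  proof -
    have "(\<lambda>p. (\<lambda>i p. B (of_int i / real (Suc k)) (fst p)) (\<lfloor>real (Suc k) * (snd p + s)\<rfloor>) p)
        \<in> borel_measurable (M \<Otimes>\<^sub>M borel)"
      by (rule measurable_compose_countable) measurable
    then show ?thesis by (simp add: case_prod_beta)
  qed
  fix p assume "p \<in> space (M \<Otimes>\<^sub>M (borel :: real measure))"
  then obtain \<omega> t where p: "p = (\<omega>, t)" "\<omega> \<in> space M" by (auto simp: space_pair_measure)
  have "(\<lambda>k. of_int \<lfloor>real (Suc k) * (t + s)\<rfloor> / real (Suc k)) \<longlonglongrightarrow> t + s"
  proof (rule LIM_zero_cancel, rule Lim_null_comparison)
    show "(\<lambda>k. 1 / real (Suc k)) \<longlonglongrightarrow> 0"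
      using LIMSEQ_inverse_real_of_nat by (simp add: inverse_eq_divide)
    have "\<bar>of_int \<lfloor>real (Suc k) * (t + s)\<rfloor> / real (Suc k) - (t + s)\<bar> \<le> 1 / real (Suc k)" for k
    proof -
      have "\<bar>of_int \<lfloor>real (Suc k) * (t + s)\<rfloor> - real (Suc k) * (t + s)\<bar> \<le> 1" by linarith
      then have "\<bar>of_int \<lfloor>real (Suc k) * (t + s)\<rfloor> - real (Suc k) * (t + s)\<bar> / real (Suc k) \<le> 1 / real (Suc k)"
        by (intro divide_right_mono) auto
      moreover have "of_int \<lfloor>real (Suc k) * (t + s)\<rfloor> / real (Suc k) - (t + s)
          = (of_int \<lfloor>real (Suc k) * (t + s)\<rfloor> - real (Suc k) * (t + s)) / real (Suc k)"
        by (simp add: diff_divide_distrib)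
      ultimately show ?thesis by simp
    qed
    then show "\<forall>\<^sub>F k in sequentially. norm (of_int \<lfloor>real (Suc k) * (t + s)\<rfloor> / real (Suc k) - (t + s)) \<le> 1 / real (Suc k)"
      by simp
  qed
  then show "(\<lambda>k. ?u k p) \<longlonglongrightarrow> (case p of (\<omega>, t) \<Rightarrow> B (t + s) \<omega>)"
    using continuous_on_tendsto_compose[OF continuous_paths[OF p(2)]] p(1) by simp
qed

text \<open>Writing \<open>s = t + q\<close> makes the index set independent of \<open>t\<close>,
  and path continuity allows rational \<open>q\<close>: a countable supremum of jointly measurable
  functions remains.\<close>

lemma workload_eq_SUP_Rats:
  assumes "\<omega> \<in> space M"
  shows "workload c B t \<omega> = (SUP q\<in>{q \<in> \<rat>. q \<le> 0}. ereal (B t \<omega> - B (t + q) \<omega> + c * q))"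
proof (rule antisym)
  show "(SUP q\<in>{q \<in> \<rat>. q \<le> 0}. ereal (B t \<omega> - B (t + q) \<omega> + c * q)) \<le> workload c B t \<omega>"
    unfolding workload_def
  proof (rule SUP_least)
    fix q :: real assume "q \<in> {q \<in> \<rat>. q \<le> 0}"
    then show "ereal (B t \<omega> - B (t + q) \<omega> + c * q)
        \<le> (SUP s\<in>{..t}. ereal (B t \<omega> - B s \<omega> - c * (t - s)))"
      by (intro SUP_upper2[of "t + q"]) (auto simp: algebra_simps)
  qed
  show "workload c B t \<omega> \<le> (SUP q\<in>{q \<in> \<rat>. q \<le> 0}. ereal (B t \<omega> - B (t + q) \<omega> + c * q))"
    unfolding workload_def
  proof (rule SUP_least)
    fix s assume s: "s \<in> {..t}"
    \<comment> \<open>The rationals approach \<open>s - t\<close> strictly from below, so that they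
      stay nonpositive even for \<open>s = t\<close>.\<close>
    have "\<exists>q\<in>\<rat>. s - t - 1 / real (Suc k) < q \<and> q < s - t" for k
      by (rule Rats_dense_in_real) simp
    then obtain q where q: "\<And>k. q k \<in> \<rat>" "\<And>k. s - t - 1 / real (Suc k) < q k" "\<And>k. q k < s - t"
      by metis
    have lim: "q \<longlonglongrightarrow> s - t"
    proof (rule tendsto_sandwich)
      show "(\<lambda>k. s - t - 1 / real (Suc k)) \<longlonglongrightarrow> s - t"
        using tendsto_diff[OF tendsto_const[of "s - t"] LIMSEQ_inverse_real_of_nat]
        by (simp add: inverse_eq_divide)
    qed (use q in \<open>auto intro!: always_eventually less_imp_le\<close>)
    have "(\<lambda>k. B (t + q k) \<omega>) \<longlonglongrightarrow> B s \<omega>"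
      using continuous_on_tendsto_compose[OF continuous_paths[OF assms], of "\<lambda>k. t + q k" s]
        tendsto_add[OF tendsto_const[of t] lim] by simp
    then have "(\<lambda>k. ereal (B t \<omega> - B (t + q k) \<omega> + c * q k)) \<longlonglongrightarrow> ereal (B t \<omega> - B s \<omega> + c * (s - t))"
      using lim by (intro tendsto_intros) auto
    moreover have "ereal (B t \<omega> - B (t + q k) \<omega> + c * q k)
        \<le> (SUP q\<in>{q \<in> \<rat>. q \<le> 0}. ereal (B t \<omega> - B (t + q) \<omega> + c * q))" for k
      using q[of k] s by (intro SUP_upper) auto
    ultimately have "ereal (B t \<omega> - B s \<omega> + c * (s - t))
        \<le> (SUP q\<in>{q \<in> \<rat>. q \<le> 0}. ereal (B t \<omega> - B (t + q) \<omega> + c * q))"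
      by (blast intro: LIMSEQ_le_const2)
    then show "ereal (B t \<omega> - B s \<omega> - c * (t - s))
        \<le> (SUP q\<in>{q \<in> \<rat>. q \<le> 0}. ereal (B t \<omega> - B (t + q) \<omega> + c * q))"
      by (simp add: algebra_simps)
  qed
qed

lemma measurable_workload_area [measurable]: "workload_area c B t \<in> borel_measurable M"
proof -
  have B [measurable]: "(\<lambda>p. B (snd p + s) (fst p)) \<in> borel_measurable (M \<Otimes>\<^sub>M borel)" for s
    using measurable_B_pair[of s] by (simp add: case_prod_beta)
  have [measurable]: "(\<lambda>p. B (snd p) (fst p)) \<in> borel_measurable (M \<Otimes>\<^sub>M borel)"
    using B[of 0] by simp
  have "countable {q :: real. q \<in> \<rat> \<and> q \<le> 0}"
    by (rule countable_subset[OF _ countable_rat]) auto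
  then have "(\<lambda>p. SUP q\<in>{q \<in> \<rat>. q \<le> 0}. ereal (B (snd p) (fst p) - B (snd p + q) (fst p) + c * q))
      \<in> borel_measurable (M \<Otimes>\<^sub>M borel)"
    by (rule borel_measurable_SUP) measurable
  then have W: "(\<lambda>p. workload c B (snd p) (fst p)) \<in> borel_measurable (M \<Otimes>\<^sub>M borel)"
    by (rule measurable_cong[THEN iffD1, rotated])
      (auto simp: space_pair_measure workload_eq_SUP_Rats)
  have "sets (M \<Otimes>\<^sub>M borel) = sets (M \<Otimes>\<^sub>M (lborel :: real measure))"
    by (rule sets_pair_measure_cong) auto
  then have [measurable]: "(\<lambda>p. workload c B (snd p) (fst p)) \<in> borel_measurable (M \<Otimes>\<^sub>M lborel)"
    using W measurable_cong_sets by blast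
  have "(\<lambda>(\<omega>, r). e2ennreal (workload c B r \<omega>) * indicator {0..t} r) \<in> borel_measurable (M \<Otimes>\<^sub>M lborel)"
    unfolding case_prod_beta by measurable
  then show ?thesis
    unfolding workload_area_def by (rule lborel.borel_measurable_nn_integral)
qed

section \<open>Tail bounds on a fixed grid\<close>

text \<open>A union bound over the cells; their number \<open>m\<close> is later independent of the
  scale.\<close>

lemma grid_oscillation_tail:
  assumes "e > 0" "x > 0" "x\<^sup>2 / (128 * e) \<ge> 16"
  obtains N where "N \<in> events" "prob N \<le> real m * (4 * exp (- (x\<^sup>2 / (128 * e))))"
    "\<And>\<omega> k r s. \<omega> \<in> space M - N \<Longrightarrow> k < m \<Longrightarrow> r \<in> {(real k - real A) * e..(real k - real A) * e + e} \<Longrightarrow>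
      s \<in> {(real k - real A) * e..(real k - real A) * e + e} \<Longrightarrow> \<bar>B r \<omega> - B s \<omega>\<bar> \<le> x"
proof -
  define P where "P k N \<longleftrightarrow> N \<in> events \<and> prob N \<le> 4 * exp (- (x\<^sup>2 / (128 * e))) \<and> (\<forall>\<omega> r s.
      \<omega> \<in> space M - N \<longrightarrow> r \<in> {(real k - real A) * e..(real k - real A) * e + e} \<longrightarrow>
      s \<in> {(real k - real A) * e..(real k - real A) * e + e} \<longrightarrow> \<bar>B r \<omega> - B s \<omega>\<bar> \<le> x)" for k :: nat and N
  have "\<exists>N. P k N" for k
  proof -
    obtain N where "N \<in> events" "prob N \<le> 4 * exp (- (x\<^sup>2 / (128 * e)))"
      "\<And>\<omega> s t. \<omega> \<in> space M - N \<Longrightarrow> s \<in> {(real k - real A) * e..(real k - real A) * e + e} \<Longrightarrow>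
        t \<in> {(real k - real A) * e..(real k - real A) * e + e} \<Longrightarrow> \<bar>B t \<omega> - B s \<omega>\<bar> \<le> x"
      using oscillation_tail[OF assms, of "(real k - real A) * e"] by blast
    then have "P k N" unfolding P_def by blast
    then show ?thesis ..
  qed
  then obtain N where N: "\<And>k. P k (N k)" by metis
  have events: "N k \<in> events" and prob: "prob (N k) \<le> 4 * exp (- (x\<^sup>2 / (128 * e)))" for k
    using N[of k] unfolding P_def by auto
  show ?thesis
  proof (rule that)
    show "(\<Union>k<m. N k) \<in> events" using events by auto
    have "prob (\<Union>k<m. N k) \<le> (\<Sum>k<m. prob (N k))"
      using events by (intro finite_measure_subadditive_finite) auto
    also have "\<dots> \<le> real m * (4 * exp (- (x\<^sup>2 / (128 * e))))"
      using sum_bounded_above[of "{..<m}" "\<lambda>k. prob (N k)"] prob by force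
    finally show "prob (\<Union>k<m. N k) \<le> real m * (4 * exp (- (x\<^sup>2 / (128 * e))))" .
  next
    fix \<omega> k r s
    assume "\<omega> \<in> space M - (\<Union>k<m. N k)" "k < m" "r \<in> {(real k - real A) * e..(real k - real A) * e + e}"
      "s \<in> {(real k - real A) * e..(real k - real A) * e + e}"
    then show "\<bar>B r \<omega> - B s \<omega>\<bar> \<le> x" using N[of k] unfolding P_def by blast
  qed
qed

text \<open>Let \<open>H\<close> be the maximal overlap. The tilt \<open>2 * c / H\<close> combines
  drift and variance into a multiple of the sum of \<open>h * (H - h)\<close>, which slow descent
  bounds below by \<open>(H^3 - H) / 6\<close>. The bound depends on the selection only through
  \<open>H\<close>, whence the form of the assumption on \<open>R\<close>.\<close>

lemma weighted_increments_tail_upper: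
  assumes "e > 0" "c > 0" "a > 0"
    and R: "\<And>H. 1 \<le> H \<Longrightarrow> H \<le> K \<Longrightarrow> R \<le> 2 * c * a / real H + c\<^sup>2 * e * (real H - 1) / 3"
  shows "prob {\<omega> \<in> space M. (\<Sum>k<A + K. real (overlap A K j k) * (B (t + real (Suc k) * e) \<omega> - B (t + real k * e) \<omega>))
      \<ge> a + c * e * (\<Sum>k<A + K. real (overlap A K j k))} \<le> exp (- R)"
proof (cases "\<exists>k<A + K. overlap A K j k \<noteq> 0")
  \<comment> \<open>With all weights zero the sum vanishes and cannot reach
    \<open>a > 0\<close>.\<close>
  case False
  then have "{\<omega> \<in> space M. (\<Sum>k<A + K. real (overlap A K j k) * (B (t + real (Suc k) * e) \<omega> - B (t + real k * e) \<omega>))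
      \<ge> a + c * e * (\<Sum>k<A + K. real (overlap A K j k))} = {}"
    using \<open>a > 0\<close> by auto
  then show ?thesis by (simp only: measure_empty exp_ge_zero)
next
  case True
  let ?h = "overlap A K j"
  define H where "H = Max (?h ` {..A + K})"
  have le_H: "?h k \<le> H" for k
  proof (cases "k \<le> A + K")
    case True
    then show ?thesis unfolding H_def by (intro Max_ge) auto
  next
    case False
    then show ?thesis by (simp add: overlap_eq_0)
  qed
  have "H \<in> ?h ` {..A + K}" unfolding H_def by (intro Max_in) auto
  then obtain k\<^sub>0 where k\<^sub>0: "H = ?h k\<^sub>0" by auto
  have H: "1 \<le> H" "H \<le> K"
    using True le_H k\<^sub>0 overlap_le[of A K j k\<^sub>0] by (auto simp: Suc_le_eq intro: Nat.gr0I)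
  let ?S1 = "\<Sum>k<A + K. real (?h k)" and ?S2 = "\<Sum>k<A + K. (real (?h k))\<^sup>2"
  obtain k\<^sub>1 where "k\<^sub>1 < A + K" "?h k\<^sub>1 \<noteq> 0" using True by blast
  then have S2: "?S2 > 0" by (intro sum_pos2[where i=k\<^sub>1]) auto
  have "(real H ^ 3 - real H) / 6 \<le> (\<Sum>k<A + K. real (?h k) * (real H - real (?h k)))"
    by (rule sum_slow_descent[OF overlap_step _ le_H k\<^sub>0]) (auto intro: overlap_eq_0)
  also have "\<dots> = real H * ?S1 - ?S2"
    by (simp add: sum_distrib_left sum_subtractf[symmetric] power2_eq_square algebra_simps)
  finally have descent: "(real H ^ 3 - real H) / 6 \<le> real H * ?S1 - ?S2" .
  have normal: "distributed M lborel (\<lambda>\<omega>. \<Sum>k<A + K. real (?h k) * (B (t + real (Suc k) * e) \<omega> - B (t + real k * e) \<omega>))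
      (normal_density 0 (sqrt (e * ?S2)))"
    using True by (intro normal_weighted_increments \<open>e > 0\<close>) auto
  define l where "l = 2 * c / real H"
  have "prob {\<omega> \<in> space M. (\<Sum>k<A + K. real (?h k) * (B (t + real (Suc k) * e) \<omega> - B (t + real k * e) \<omega>))
      \<ge> a + c * e * ?S1} \<le> exp (- (l * (a + c * e * ?S1)) + l\<^sup>2 * (sqrt (e * ?S2))\<^sup>2 / 2)"
    using S2 \<open>e > 0\<close> \<open>c > 0\<close> by (intro normal_tail_upper[OF normal]) (auto simp: l_def)
  also have "\<dots> \<le> exp (- R)"
  proof -
    have "l * (a + c * e * ?S1) - l\<^sup>2 * (sqrt (e * ?S2))\<^sup>2 / 2
        = 2 * c * a / real H + 2 * c\<^sup>2 * e / (real H)\<^sup>2 * (real H * ?S1 - ?S2)"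
      using S2 \<open>e > 0\<close> H by (simp add: l_def field_simps power2_eq_square)
    also have "\<dots> \<ge> 2 * c * a / real H + 2 * c\<^sup>2 * e / (real H)\<^sup>2 * ((real H ^ 3 - real H) / 6)"
      using descent \<open>e > 0\<close> by (intro add_left_mono mult_left_mono) auto
    also have "2 * c\<^sup>2 * e / (real H)\<^sup>2 * ((real H ^ 3 - real H) / 6) = c\<^sup>2 * e / 3 * (real H - 1 / real H)"
      using H by (simp add: field_simps power2_eq_square power3_eq_cube)
    finally have "2 * c * a / real H + c\<^sup>2 * e / 3 * (real H - 1 / real H)
        \<le> l * (a + c * e * ?S1) - l\<^sup>2 * (sqrt (e * ?S2))\<^sup>2 / 2" .
    \<comment> \<open>Since \<open>H \<ge> 1\<close>, replacing \<open>1 / H\<close> by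
      \<open>1\<close> is a slight loss that leaves an expression linear in
      \<open>H\<close>.\<close>
    moreover have "c\<^sup>2 * e / 3 * (real H - 1) \<le> c\<^sup>2 * e / 3 * (real H - 1 / real H)"
      using H \<open>e > 0\<close> by (intro mult_left_mono diff_left_mono) auto
    moreover have "R \<le> 2 * c * a / real H + c\<^sup>2 * e / 3 * (real H - 1)" using R[OF H] by simp
    ultimately have "R \<le> l * (a + c * e * ?S1) - l\<^sup>2 * (sqrt (e * ?S2))\<^sup>2 / 2" by linarith
    then show ?thesis by simp
  qed
  finally show ?thesis .
qed

text \<open>A large area forces a large oscillation in some cell, an exceptional remote past, or a
  large weighted sum for one of finitely many selections. Here \<open>a\<close> is the level per
  cell length after deducting the discretisation error of all \<open>K\<close> cells.\<close>

lemma workload_area_tail_upper: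
  assumes "e > 0" "c > 0" "K > 0" "x > 0" and x: "x\<^sup>2 / (128 * e) \<ge> 16"
    and L: "c\<^sup>2 * (real A * e) / 256 \<ge> 16"
    and a: "a = V / e - real K * (2 * x + c * e)" "a > 0"
    and R: "\<And>H. 1 \<le> H \<Longrightarrow> H \<le> K \<Longrightarrow> R \<le> 2 * c * a / real H + c\<^sup>2 * e * (real H - 1) / 3"
  shows "prob {\<omega> \<in> space M. workload_area c B (real K * e) \<omega> \<ge> ennreal V}
    \<le> real (A + K) * (4 * exp (- (x\<^sup>2 / (128 * e)))) + 8 * exp (- (c\<^sup>2 * (real A * e) / 256))
      + real (card (\<Pi>\<^sub>E i\<in>{..<K}. {..A + i})) * exp (- R)"
proof -
  let ?J = "\<Pi>\<^sub>E i\<in>{..<K}. {..A + i}"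
  have finite_J: "finite ?J" by (intro finite_PiE) auto
  define D where "D j \<omega> = (\<Sum>k<A + K. real (overlap A K j k) *
    (B (- (real A * e) + real (Suc k) * e) \<omega> - B (- (real A * e) + real k * e) \<omega>))" for j \<omega>
  define F where "F j = {\<omega> \<in> space M. D j \<omega> \<ge> a + c * e * (\<Sum>k<A + K. real (overlap A K j k))}" for j
  have F: "F j \<in> events" for j unfolding F_def D_def by measurable
  have UN_F: "(\<Union>j\<in>?J. F j) \<in> events"
    using finite_J F by (intro sets.finite_UN)
  have prob_F: "prob (F j) \<le> exp (- R)" for j
    unfolding F_def D_def using assms by (intro weighted_increments_tail_upper) auto
  obtain N1 where N1: "N1 \<in> events" "prob N1 \<le> real (A + K) * (4 * exp (- (x\<^sup>2 / (128 * e))))"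
    "\<And>\<omega> k r s. \<omega> \<in> space M - N1 \<Longrightarrow> k < A + K \<Longrightarrow> r \<in> {(real k - real A) * e..(real k - real A) * e + e} \<Longrightarrow>
      s \<in> {(real k - real A) * e..(real k - real A) * e + e} \<Longrightarrow> \<bar>B r \<omega> - B s \<omega>\<bar> \<le> x"
    using grid_oscillation_tail[OF \<open>e > 0\<close> \<open>x > 0\<close> x, of "A + K" A] by blast
  have "real A * e > 0" using L \<open>e > 0\<close> by (cases "A = 0") auto
  then obtain N2 where N2: "N2 \<in> events" "prob N2 \<le> 8 * exp (- (c\<^sup>2 * (real A * e) / 256))"
    "\<And>\<omega> s. \<omega> \<in> space M - N2 \<Longrightarrow> s \<le> - (real A * e) \<Longrightarrow> - B s \<omega> + c * s \<le> 0"
    using remote_past_tail[OF \<open>c > 0\<close> _ L] by blast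
  have "{\<omega> \<in> space M. workload_area c B (real K * e) \<omega> \<ge> ennreal V} \<subseteq> (N1 \<union> N2) \<union> (\<Union>j\<in>?J. F j)"
  proof (rule subsetI, rule ccontr)
    fix \<omega> assume \<omega>: "\<omega> \<in> {\<omega> \<in> space M. workload_area c B (real K * e) \<omega> \<ge> ennreal V}"
      and contra: "\<omega> \<notin> (N1 \<union> N2) \<union> (\<Union>j\<in>?J. F j)"
    have past: "B 0 \<omega> - B s \<omega> + c * s \<le> 0" if "s \<le> - (real A * e)" for s
      using N2(3)[of \<omega> s] that \<omega> contra B_zero[of \<omega>] by auto
    have osc: "\<bar>B r \<omega> - B s \<omega>\<bar> \<le> x"
      if "k < A + K" "r \<in> {(real k - real A) * e..(real k - real A) * e + e}"
        "s \<in> {(real k - real A) * e..(real k - real A) * e + e}" for k r s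
      using N1(3)[OF _ that] \<omega> contra by auto
    obtain j where j: "j \<in> ?J" "workload_area c B (real K * e) \<omega>
        \<le> ennreal (e * (\<Sum>i<K. grid_value c B \<omega> A e (A + i) - grid_value c B \<omega> A e (j i) + (2 * x + c * e)))"
      by (rule workload_area_le_grid[where B=B and \<omega>=\<omega> and x=x and A=A,
            OF \<open>e > 0\<close> less_imp_le[OF \<open>c > 0\<close>] \<open>K > 0\<close> osc past])
    have le: "j i \<le> A + i" if "i < K" for i using j(1) that by (auto simp: PiE_iff)
    have "V / e = a + real K * (2 * x + c * e)" using a by simp
    then have V: "V = e * (a + real K * (2 * x + c * e))" using \<open>e > 0\<close> by (simp add: field_simps)
    \<comment> \<open>With \<open>V > 0\<close> the comparison in \<open>ennreal\<close> is a
      genuine one between reals, not an effect of truncation at zero.\<close>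
    have "0 < a + real K * (2 * x + c * e)" using a \<open>x > 0\<close> \<open>c > 0\<close> \<open>e > 0\<close> by (intro add_pos_nonneg) auto
    then have "V > 0" unfolding V using \<open>e > 0\<close> by simp
    have "ennreal V \<le> ennreal (e * (\<Sum>i<K. grid_value c B \<omega> A e (A + i) - grid_value c B \<omega> A e (j i) + (2 * x + c * e)))"
      using \<omega> j(2) by auto
    then have "V \<le> e * (\<Sum>i<K. grid_value c B \<omega> A e (A + i) - grid_value c B \<omega> A e (j i) + (2 * x + c * e))"
      using \<open>V > 0\<close> by (subst (asm) ennreal_le_iff2) auto
    then have "a + real K * (2 * x + c * e)
        \<le> (\<Sum>i<K. grid_value c B \<omega> A e (A + i) - grid_value c B \<omega> A e (j i) + (2 * x + c * e))"
      unfolding V using \<open>e > 0\<close> by simp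
    also have "\<dots> = (\<Sum>i<K. grid_value c B \<omega> A e (A + i) - grid_value c B \<omega> A e (j i)) + real K * (2 * x + c * e)"
      by (simp only: sum.distrib sum_constant card_lessThan distrib_left)
    also have "(\<Sum>i<K. grid_value c B \<omega> A e (A + i) - grid_value c B \<omega> A e (j i))
        = D j \<omega> - c * e * (\<Sum>k<A + K. real (overlap A K j k))"
      unfolding D_def by (rule sum_grid_value) (rule le)
    finally have "\<omega> \<in> F j" using \<omega> by (simp add: F_def)
    then show False using contra j(1) by blast
  qed
  then have "prob {\<omega> \<in> space M. workload_area c B (real K * e) \<omega> \<ge> ennreal V} \<le> prob ((N1 \<union> N2) \<union> (\<Union>j\<in>?J. F j))"
    using N1(1) N2(1) UN_F by (intro finite_measure_mono sets.Un)
  also have "\<dots> \<le> prob (N1 \<union> N2) + prob (\<Union>j\<in>?J. F j)"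
    using N1(1) N2(1) UN_F by (intro measure_Un_le sets.Un)
  finally have "prob {\<omega> \<in> space M. workload_area c B (real K * e) \<omega> \<ge> ennreal V}
    \<le> prob (N1 \<union> N2) + prob (\<Union>j\<in>?J. F j)" .
  moreover have "prob (N1 \<union> N2) \<le> prob N1 + prob N2"
    using N1(1) N2(1) by (rule measure_Un_le)
  moreover have "prob (\<Union>j\<in>?J. F j) \<le> (\<Sum>j\<in>?J. prob (F j))"
    by (rule finite_measure_subadditive_finite[OF finite_J]) (rule image_subsetI, rule F)
  moreover have "(\<Sum>j\<in>?J. prob (F j)) \<le> of_nat (card ?J) * exp (- R)"
    by (rule sum_bounded_above) (rule prob_F)
  ultimately show ?thesis using N1(2) N2(2) by linarith
qed

text \<open>The constant selection bounds the area below by one normal variable of variance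
  \<open>e * S2\<close>, and \<open>X\<close> is the level it must reach to make up for drift and
  discretisation. Only the oscillation event is subtracted, because a single past time bounds the
  supremum from below.\<close>

lemma workload_area_tail_lower:
  fixes A K :: nat and e c x V X :: real
  assumes "e > 0" "c > 0" "K > 1" "x > 0" and x: "x\<^sup>2 / (128 * e) \<ge> 16" and t: "real K * e \<le> t" and "V > 0"
  defines "S1 \<equiv> real A * real K + (\<Sum>l<K. real l)"
    and "S2 \<equiv> real A * (real K)\<^sup>2 + (\<Sum>l<K. (real l)\<^sup>2)"
  assumes X: "X = V / e + real K * (x + c * e) + c * e * S1"
  shows "prob {\<omega> \<in> space M. workload_area c B t \<omega> \<ge> ennreal V}
    \<ge> exp (- (X + 1)\<^sup>2 / (2 * (e * S2))) / sqrt (2 * pi * (e * S2)) - real (A + K) * (4 * exp (- (x\<^sup>2 / (128 * e))))"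
proof -
  define h where "h k = overlap A K (\<lambda>_. 0) k" for k
  have S1: "(\<Sum>k<A + K. real (h k)) = S1" and S2: "(\<Sum>k<A + K. (real (h k))\<^sup>2) = S2"
    unfolding S1_def S2_def h_def by (rule sum_overlap_0)+
  have S1_nonneg: "S1 \<ge> 0" unfolding S1_def by (intro add_nonneg_nonneg sum_nonneg) auto
  have "(\<Sum>l<K. (real l)\<^sup>2) > 0"
    using \<open>K > 1\<close> by (intro sum_pos2[where i=1]) auto
  then have S2_pos: "S2 > 0" unfolding S2_def by (intro add_nonneg_pos) auto
  have nz: "\<exists>k<A + K. real (h k) \<noteq> 0"
  proof (rule ccontr)
    assume "\<not> ?thesis"
    then have "(\<Sum>k<A + K. (real (h k))\<^sup>2) = 0" by (intro sum.neutral) auto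
    then show False using S2 S2_pos by simp
  qed
  define D where "D \<omega> = (\<Sum>k<A + K. real (h k) *
    (B (- (real A * e) + real (Suc k) * e) \<omega> - B (- (real A * e) + real k * e) \<omega>))" for \<omega>
  have [measurable]: "D \<in> borel_measurable M" unfolding D_def by measurable
  have normal: "distributed M lborel D (normal_density 0 (sqrt (e * S2)))"
    unfolding D_def S2[symmetric] by (rule normal_weighted_increments[OF \<open>e > 0\<close> nz])
  have "X \<ge> 0"
    unfolding X using assms(1-4) \<open>V > 0\<close> S1_nonneg by (intro add_nonneg_nonneg mult_nonneg_nonneg) auto
  obtain N where N: "N \<in> events" "prob N \<le> real (A + K) * (4 * exp (- (x\<^sup>2 / (128 * e))))"
    "\<And>\<omega> k r s. \<omega> \<in> space M - N \<Longrightarrow> k < A + K \<Longrightarrow> r \<in> {(real k - real A) * e..(real k - real A) * e + e} \<Longrightarrow>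
      s \<in> {(real k - real A) * e..(real k - real A) * e + e} \<Longrightarrow> \<bar>B r \<omega> - B s \<omega>\<bar> \<le> x"
    using grid_oscillation_tail[OF \<open>e > 0\<close> \<open>x > 0\<close> x, of "A + K" A] by blast
  have "{\<omega> \<in> space M. D \<omega> \<ge> X} \<subseteq> {\<omega> \<in> space M. workload_area c B t \<omega> \<ge> ennreal V} \<union> N"
  proof (intro subsetI, rule ccontr)
    fix \<omega> assume \<omega>: "\<omega> \<in> {\<omega> \<in> space M. D \<omega> \<ge> X}"
      and contra: "\<omega> \<notin> {\<omega> \<in> space M. workload_area c B t \<omega> \<ge> ennreal V} \<union> N"
    have "ennreal (e * (\<Sum>i<K. grid_value c B \<omega> A e (A + i) - grid_value c B \<omega> A e 0 - (x + c * e)))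
        \<le> workload_area c B t \<omega>"
      using \<omega> contra \<open>c > 0\<close> by (intro workload_area_ge_grid[OF \<open>e > 0\<close> _ t] N(3)) auto
    also have "(\<Sum>i<K. grid_value c B \<omega> A e (A + i) - grid_value c B \<omega> A e 0 - (x + c * e))
        = D \<omega> - c * e * S1 - real K * (x + c * e)"
      using sum_grid_value[of K "\<lambda>_. 0" A c B \<omega> e] by (simp add: sum_subtractf[of _ "\<lambda>_. x + c * e"] D_def S1[symmetric] h_def)
    finally have "ennreal (e * (D \<omega> - c * e * S1 - real K * (x + c * e))) \<le> workload_area c B t \<omega>" .
    moreover have "V \<le> e * (D \<omega> - c * e * S1 - real K * (x + c * e))"
    proof -
      have "V / e \<le> D \<omega> - c * e * S1 - real K * (x + c * e)" using \<omega> X by auto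
      then show ?thesis using \<open>e > 0\<close> by (simp add: divide_le_eq mult.commute)
    qed
    ultimately have "ennreal V \<le> workload_area c B t \<omega>"
      by (meson ennreal_leI order.trans)
    then show False using contra \<omega> by auto
  qed
  then have "prob {\<omega> \<in> space M. D \<omega> \<ge> X} \<le> prob ({\<omega> \<in> space M. workload_area c B t \<omega> \<ge> ennreal V} \<union> N)"
    using N(1) by (intro finite_measure_mono) auto
  also have "\<dots> \<le> prob {\<omega> \<in> space M. workload_area c B t \<omega> \<ge> ennreal V} + prob N"
    using N(1) by (intro measure_Un_le) auto
  finally show ?thesis
    using normal_tail_lower[OF normal _ \<open>X \<ge> 0\<close>] N(2) S2_pos \<open>e > 0\<close> by simp
qed

end

section \<open>The decay rate\<close>

text \<open>\<open>S\<close> is the minimiser of \<open>2 * c * M / G + c^2 * G / 3\<close> over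
  \<open>0 < G \<le> T\<close>. At the interior minimiser both terms coincide, which gives the first
  case of the definition.\<close>

lemma decay_rate_eq_min:
  assumes "c > 0" "T > 0" "M > 0" and S: "S = min T (sqrt (6 * M / c))"
  shows "decay_rate c T M = 2 * c * M / S + c\<^sup>2 * S / 3"
proof (cases "sqrt (6 * M / c) < T")
  case True
  then have "S = sqrt (6 * M / c)" using S by simp
  then have S2: "S\<^sup>2 = 6 * M / c" and "S > 0" using assms by simp_all
  have "c * S = sqrt (c\<^sup>2 * S\<^sup>2)" using \<open>S > 0\<close> \<open>c > 0\<close> by (simp add: real_sqrt_mult)
  also have "c\<^sup>2 * S\<^sup>2 = 6 * (c * M)" unfolding S2 using \<open>c > 0\<close> by (simp add: power2_eq_square)
  finally have "sqrt 6 * sqrt (c * M) = c * S" by (simp add: real_sqrt_mult)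
  moreover have "decay_rate c T M = 2 / 3 * c * (sqrt 6 * sqrt (c * M))"
    using True by (simp add: decay_rate_def)
  moreover have "2 * c * M / S = c\<^sup>2 * S / 3"
  proof -
    have M: "M = c * S\<^sup>2 / 6" using S2 \<open>c > 0\<close> by simp
    show ?thesis by (subst M) (use \<open>S > 0\<close> in \<open>simp add: power2_eq_square\<close>)
  qed
  ultimately have "decay_rate c T M = 2 * (c\<^sup>2 * S / 3)" by (simp add: power2_eq_square)
  then show ?thesis by (subst \<open>2 * c * M / S = c\<^sup>2 * S / 3\<close>) simp
next
  case False
  then show ?thesis using S by (simp add: decay_rate_def)
qed

text \<open>The difference to the value at \<open>S\<close> carries the factor
  \<open>(G - S) * (G * S - 6 * M / c)\<close>. At the interior minimiser this is
  \<open>S * (G - S)^2\<close>; for \<open>S = T\<close> both factors are nonpositive.\<close>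

lemma decay_rate_le:
  assumes "c > 0" "T > 0" "M > 0" "0 < G" "G \<le> T"
  shows "decay_rate c T M \<le> 2 * c * M / G + c\<^sup>2 * G / 3"
proof -
  define S where "S = min T (sqrt (6 * M / c))"
  have "S > 0" using assms by (simp add: S_def)
  have "(2 * c * M / G + c\<^sup>2 * G / 3) - (2 * c * M / S + c\<^sup>2 * S / 3)
      = c\<^sup>2 / (3 * G * S) * ((G - S) * (G * S - 6 * M / c))"
    using assms \<open>S > 0\<close> by (simp add: field_simps power2_eq_square)
  moreover have "(G - S) * (G * S - 6 * M / c) \<ge> 0"
  proof (cases "sqrt (6 * M / c) < T")
    case True
    then have "S = sqrt (6 * M / c)" by (simp add: S_def)
    then have "6 * M / c = S * S" using assms by simp
    then have "(G - S) * (G * S - 6 * M / c) = S * (G - S)\<^sup>2" by (simp add: power2_eq_square algebra_simps)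
    then show ?thesis using \<open>S > 0\<close> by simp
  next
    case False
    then have "S = T" by (simp add: S_def)
    have "T\<^sup>2 \<le> (sqrt (6 * M / c))\<^sup>2" using False \<open>T > 0\<close> by (intro power_mono) auto
    then have "T * T \<le> 6 * M / c" using assms by (simp add: power2_eq_square)
    moreover have "G * S \<le> T * T" using assms \<open>S = T\<close> by (intro mult_mono) auto
    ultimately have "G * S - 6 * M / c \<le> 0" by linarith
    then show ?thesis using assms \<open>S = T\<close> by (intro mult_nonpos_nonpos) auto
  qed
  ultimately have "(2 * c * M / G + c\<^sup>2 * G / 3) - (2 * c * M / S + c\<^sup>2 * S / 3) \<ge> 0"
    using \<open>S > 0\<close> assms by simp
  then show ?thesis using decay_rate_eq_min[OF assms(1-3) S_def] by simp
qed

section \<open>Exponential bounds on the scale \<open>n = sqrt u\<close>\<close>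

context two_sided_brownian_motion
begin

text \<open>The number \<open>K\<close> of cells is fixed first, depending on
  \<open>\<epsilon>\<close>. Cell length, oscillation and past horizon are then proportional to
  \<open>n\<close>, so every exponent is linear in \<open>n\<close> and only the rates have to be
  compared.\<close>

lemma eventually_workload_area_tail_upper:
  assumes "c > 0" "T > 0" "Ma > 0" "\<epsilon> > 0"
  shows "\<forall>\<^sub>F n in at_top. prob {\<omega> \<in> space M. workload_area c B (T * n) \<omega> \<ge> ennreal (Ma * n\<^sup>2)}
    \<le> exp (- (n * (decay_rate c T Ma - \<epsilon>)))"
proof -
  define \<phi> where "\<phi> = decay_rate c T Ma"
  \<comment> \<open>With the fourth root, \<open>\<eta>\<close> vanishes while the cost \<open>\<eta>\<^sup>2 / d\<close> of an oscillation of size \<open>\<eta>\<close> in a cell diverges.\<close>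
  define \<eta> where "\<eta> K = sqrt (sqrt (1 / real K))" for K :: nat
  define d where "d K = T / real K" for K :: nat
  \<comment> \<open>The area left, in units of \<open>n^2\<close>, after the discretisation error of
    the grid.\<close>
  define M' where "M' K = Ma - T * (2 * \<eta> K + c * d K)" for K
  \<comment> \<open>The past horizon \<open>m * T * n\<close> makes the remote past at least as
    costly as \<open>\<phi>\<close>; the summand \<open>1 / T\<close> ensures
    \<open>m > 0\<close>.\<close>
  obtain m :: nat where "256 * \<phi> / (c\<^sup>2 * T) + 1 / T \<le> real m" using real_arch_simple by blast
  have m_pos: "real m > 0"
  proof -
    have "\<phi> \<ge> 0" using decay_rate_eq_min[OF assms(1-3) refl] assms by (simp add: \<phi>_def)
    then have "0 < 256 * \<phi> / (c\<^sup>2 * T) + 1 / T" using assms by (intro add_nonneg_pos) auto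
    then show ?thesis using \<open>_ \<le> real m\<close> by linarith
  qed
  have m: "c\<^sup>2 * (real m * T) / 256 \<ge> \<phi>"
  proof -
    have "256 * \<phi> / (c\<^sup>2 * T) \<le> real m" using \<open>_ \<le> real m\<close> \<open>T > 0\<close> by (smt (verit) divide_pos_pos)
    then show ?thesis using assms by (simp add: field_simps)
  qed
  have inv: "(\<lambda>K. 1 / real K) \<longlonglongrightarrow> 0" by (rule lim_1_over_n)
  have \<eta>_lim: "\<eta> \<longlonglongrightarrow> 0"
    unfolding \<eta>_def using tendsto_real_sqrt[OF tendsto_real_sqrt[OF inv]] by simp
  have d_lim: "d \<longlonglongrightarrow> 0"
    using tendsto_mult[OF tendsto_const[of T] inv] by (simp add: d_def[abs_def])
  have M'_lim: "M' \<longlonglongrightarrow> Ma"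
    unfolding M'_def by (rule tendsto_eq_intros \<eta>_lim d_lim refl | simp)+
  have rate_lim: "(\<lambda>K. M' K / Ma * \<phi> - c\<^sup>2 * d K / 3) \<longlonglongrightarrow> \<phi>"
    by (rule tendsto_eq_intros M'_lim d_lim refl | use \<open>Ma > 0\<close> in simp)+
  have "filterlim (\<lambda>K. sqrt (real K)) at_top sequentially"
    by (rule filterlim_compose[OF sqrt_at_top filterlim_real_sequentially])
  then have "\<forall>\<^sub>F K in sequentially. 128 * T * \<phi> \<le> sqrt (real K)"
    by (simp add: filterlim_at_top)
  moreover have "\<forall>\<^sub>F K in sequentially. 0 < M' K"
    by (rule order_tendstoD(1)[OF M'_lim \<open>Ma > 0\<close>])
  moreover have "\<forall>\<^sub>F K in sequentially. \<phi> - \<epsilon> / 2 < M' K / Ma * \<phi> - c\<^sup>2 * d K / 3"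
    using \<open>\<epsilon> > 0\<close> by (intro order_tendstoD(1)[OF rate_lim]) simp
  ultimately have "\<forall>\<^sub>F K in sequentially. K > 0 \<and> 128 * T * \<phi> \<le> sqrt (real K) \<and> 0 < M' K \<and>
      \<phi> - \<epsilon> / 2 < M' K / Ma * \<phi> - c\<^sup>2 * d K / 3"
    using eventually_gt_at_top[of 0] by eventually_elim auto
  then obtain K where K: "K > 0" "128 * T * \<phi> \<le> sqrt (real K)" "0 < M' K"
      "\<phi> - \<epsilon> / 2 < M' K / Ma * \<phi> - c\<^sup>2 * d K / 3"
    using eventually_happens'[OF sequentially_bot] by blast
  have d_pos: "d K > 0" and Kd: "real K * d K = T" using K(1) \<open>T > 0\<close> by (auto simp: d_def)
  have \<eta>_pos: "\<eta> K > 0" using K(1) by (simp add: \<eta>_def)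
  \<comment> \<open>The rate of an oscillation failure; it grows like \<open>sqrt K\<close>, so a
    fine grid brings it above \<open>\<phi>\<close>.\<close>
  define b where "b = sqrt (real K) / (128 * T)"
  have b: "b \<ge> \<phi>" "b > 0" using K(1,2) \<open>T > 0\<close> by (auto simp: b_def field_simps)
  have \<eta>_d: "(\<eta> K)\<^sup>2 / (128 * d K) = b"
    using \<open>T > 0\<close> K(1) by (simp add: \<eta>_def d_def b_def real_sqrt_divide field_simps)
  define J where "J = real (card (\<Pi>\<^sub>E i\<in>{..<K}. {..m * K + i}))"
  define C where "C = real (m * K + K) * 4 + 8 + J"
  have "M' K \<le> Ma" using assms \<eta>_pos d_pos by (simp add: M'_def)
  have "\<forall>\<^sub>F n in at_top. n \<ge> 1 \<and> n \<ge> 16 / b \<and> n \<ge> 16 / (c\<^sup>2 * (real m * T) / 256) \<and> n \<ge> C / (\<epsilon> / 2)"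
    by (intro eventually_conj eventually_ge_at_top)
  then show ?thesis
  proof eventually_elim
    case (elim n)
    have pos: "c\<^sup>2 * (real m * T) / 256 > 0" using m_pos assms by simp
    have "n > 0" using elim by simp
    have n: "n * b \<ge> 16" "n * (c\<^sup>2 * (real m * T) / 256) \<ge> 16" "n * (\<epsilon> / 2) \<ge> C"
      using elim b(2) pos \<open>\<epsilon> > 0\<close> by (simp_all add: pos_divide_le_eq)
    have x: "(\<eta> K * n)\<^sup>2 / (128 * (d K * n)) = n * b"
      using \<open>n > 0\<close> by (simp add: \<eta>_d[symmetric] power2_eq_square)
    have past: "c\<^sup>2 * (real (m * K) * (d K * n)) / 256 = n * (c\<^sup>2 * (real m * T) / 256)"
      by (simp add: Kd[symmetric])
    have T: "real K * (d K * n) = T * n" by (simp add: Kd[symmetric])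
    have a: "Ma * n\<^sup>2 / (d K * n) - real K * (2 * (\<eta> K * n) + c * (d K * n)) = n * M' K / d K"
      using \<open>n > 0\<close> d_pos by (simp add: M'_def Kd[symmetric] field_simps power2_eq_square)
    \<comment> \<open>With \<open>G = H * d K \<le> T\<close> this is the minimality of the decay
      rate, scaled by \<open>M' K / Ma \<le> 1\<close>; the discrete \<open>H - 1\<close> costs
      \<open>c^2 * d K / 3\<close>.\<close>
    have R: "n * (\<phi> - \<epsilon> / 2) \<le> 2 * c * (n * M' K / d K) / real H + c\<^sup>2 * (d K * n) * (real H - 1) / 3"
      if H: "1 \<le> H" "H \<le> K" for H
    proof -
      define G where "G = real H * d K"
      have "G \<le> real K * d K" unfolding G_def using H d_pos by (intro mult_right_mono) auto
      then have G: "0 < G" "G \<le> T" using H d_pos Kd by (auto simp: G_def)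
      have "M' K / Ma * \<phi> \<le> M' K / Ma * (2 * c * Ma / G + c\<^sup>2 * G / 3)"
        unfolding \<phi>_def using decay_rate_le[OF assms(1-3) G] K(3) assms by (intro mult_left_mono) auto
      also have "\<dots> = 2 * c * M' K / G + M' K / Ma * (c\<^sup>2 * G / 3)"
        using \<open>Ma > 0\<close> by (simp add: field_simps)
      also have "M' K / Ma * (c\<^sup>2 * G / 3) \<le> 1 * (c\<^sup>2 * G / 3)"
        using \<open>M' K \<le> Ma\<close> assms G by (intro mult_right_mono) auto
      finally have "\<phi> - \<epsilon> / 2 \<le> 2 * c * M' K / G + c\<^sup>2 * G / 3 - c\<^sup>2 * d K / 3"
        using K(4) by linarith
      then have "n * (\<phi> - \<epsilon> / 2) \<le> n * (2 * c * M' K / G + c\<^sup>2 * G / 3 - c\<^sup>2 * d K / 3)"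
        using \<open>n > 0\<close> by (intro mult_left_mono) auto
      also have "\<dots> = 2 * c * (n * M' K / d K) / real H + c\<^sup>2 * (d K * n) * (real H - 1) / 3"
        using H d_pos by (simp add: G_def field_simps)
      finally show ?thesis .
    qed
    have "prob {\<omega> \<in> space M. workload_area c B (real K * (d K * n)) \<omega> \<ge> ennreal (Ma * n\<^sup>2)}
      \<le> real (m * K + K) * (4 * exp (- ((\<eta> K * n)\<^sup>2 / (128 * (d K * n)))))
        + 8 * exp (- (c\<^sup>2 * (real (m * K) * (d K * n)) / 256))
        + real (card (\<Pi>\<^sub>E i\<in>{..<K}. {..m * K + i})) * exp (- (n * (\<phi> - \<epsilon> / 2)))"
    proof (rule workload_area_tail_upper)
      show "0 < d K * n" "0 < \<eta> K * n" using d_pos \<eta>_pos \<open>n > 0\<close> by auto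
      show "16 \<le> (\<eta> K * n)\<^sup>2 / (128 * (d K * n))" unfolding x by (rule n(1))
      show "16 \<le> c\<^sup>2 * (real (m * K) * (d K * n)) / 256" unfolding past by (rule n(2))
      show "n * M' K / d K > 0" using \<open>n > 0\<close> K(3) d_pos by simp
    qed (use assms K(1) a R in auto)
    then have "prob {\<omega> \<in> space M. workload_area c B (T * n) \<omega> \<ge> ennreal (Ma * n\<^sup>2)}
      \<le> real (m * K + K) * (4 * exp (- (n * b))) + 8 * exp (- (n * (c\<^sup>2 * (real m * T) / 256)))
        + J * exp (- (n * (\<phi> - \<epsilon> / 2)))"
      unfolding x past T J_def .
    also have "\<dots> \<le> real (m * K + K) * (4 * exp (- (n * (\<phi> - \<epsilon> / 2)))) + 8 * exp (- (n * (\<phi> - \<epsilon> / 2)))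
        + J * exp (- (n * (\<phi> - \<epsilon> / 2)))"
      using b(1) m \<open>n > 0\<close> \<open>\<epsilon> > 0\<close> by (intro add_mono mult_left_mono iffD2[OF exp_le_cancel_iff] le_imp_neg_le) (auto simp: J_def)
    also have "\<dots> = C * exp (- (n * (\<phi> - \<epsilon> / 2)))" by (simp add: C_def algebra_simps)
    \<comment> \<open>The constant \<open>C\<close>, which does not depend on \<open>n\<close>, is
      absorbed by the remaining half of \<open>\<epsilon>\<close>.\<close>
    also have "\<dots> \<le> exp (n * (\<epsilon> / 2)) * exp (- (n * (\<phi> - \<epsilon> / 2)))"
      using n(3) exp_ge_add_one_self[of "n * (\<epsilon> / 2)"] by (intro mult_right_mono) (linarith, simp)
    also have "\<dots> = exp (- (n * (\<phi> - \<epsilon>)))" by (simp add: exp_add[symmetric] algebra_simps)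
    finally show ?case unfolding \<phi>_def .
  qed
qed

text \<open>For the constant selection \<open>- p * n\<close> with horizon \<open>S * n\<close>, the
  limiting level is \<open>Ma + c * (S * p + S^2 / 2)\<close> and the limiting variance
  \<open>S^2 * p + S^3 / 3\<close>, in units of \<open>n^2\<close> and \<open>n^3\<close>. Half the
  squared level over the variance is \<open>\<phi>\<close>.\<close>

lemma eventually_workload_area_tail_lower:
  assumes "c > 0" "T > 0" "Ma > 0" "\<epsilon> > 0"
  shows "\<forall>\<^sub>F n in at_top. prob {\<omega> \<in> space M. workload_area c B (T * n) \<omega> \<ge> ennreal (Ma * n\<^sup>2)}
    \<ge> exp (- (n * (decay_rate c T Ma + \<epsilon>)))"
proof -
  define \<phi> where "\<phi> = decay_rate c T Ma"
  define S where "S = min T (sqrt (6 * Ma / c))"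
  \<comment> \<open>This \<open>p\<close> minimises that quotient; it solves
    \<open>Ma = c * (S * p + S^2 / 6)\<close> and is zero when
    \<open>S = sqrt (6 * Ma / c)\<close>.\<close>
  define p where "p = Ma / (c * S) - S / 6"
  have S: "S > 0" "S \<le> T" using assms by (auto simp: S_def)
  have "p \<ge> 0"
  proof -
    have "S\<^sup>2 \<le> (sqrt (6 * Ma / c))\<^sup>2" using S by (intro power_mono) (auto simp: S_def)
    then have "S\<^sup>2 \<le> 6 * Ma / c" using assms by simp
    then show ?thesis using S assms by (simp add: p_def field_simps power2_eq_square)
  qed
  have \<phi>: "\<phi> = (Ma + c * (S * p + S\<^sup>2 / 2))\<^sup>2 / (2 * (S\<^sup>2 * p + S ^ 3 / 3))"
  proof -
    have Ma: "Ma = c * (S * p + S\<^sup>2 / 6)" using S assms by (simp add: p_def field_simps power2_eq_square)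
    have "S * p + S\<^sup>2 / 3 > 0" using S \<open>p \<ge> 0\<close> by (intro add_nonneg_pos) auto
    then have nz: "S\<^sup>2 * p + S ^ 3 / 3 = S * (S * p + S\<^sup>2 / 3)" "S * p + S\<^sup>2 / 3 \<noteq> 0"
      by (auto simp: power2_eq_square power3_eq_cube algebra_simps)
    \<comment> \<open>With \<open>q = S * p + S^2 / 3\<close> the level is \<open>2 * c * q\<close>
      and the variance \<open>S * q\<close>, so the quotient collapses to
      \<open>2 * c^2 * q / S\<close>.\<close>
    have "Ma + c * (S * p + S\<^sup>2 / 2) = 2 * c * (S * p + S\<^sup>2 / 3)"
      by (subst Ma) (simp add: algebra_simps)
    then have "(Ma + c * (S * p + S\<^sup>2 / 2))\<^sup>2 / (2 * (S\<^sup>2 * p + S ^ 3 / 3)) = 2 * c\<^sup>2 * (S * p + S\<^sup>2 / 3) / S"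
      unfolding nz(1) using nz(2) S(1) by (simp add: power2_eq_square)
    also have "\<dots> = 2 * c * Ma / S + c\<^sup>2 * S / 3"
      by (subst Ma) (use S(1) in \<open>simp add: field_simps power2_eq_square\<close>)
    also have "\<dots> = \<phi>" unfolding \<phi>_def by (rule decay_rate_eq_min[OF assms(1-3) S_def, symmetric])
    finally show ?thesis ..
  qed
  define \<eta> where "\<eta> K = sqrt (sqrt (1 / real K))" for K :: nat
  define d where "d K = S / real K" for K :: nat
  define A where "A K = nat \<lfloor>p / S * real K\<rfloor>" for K :: nat
  define S1 where "S1 K = real (A K) * real K + (\<Sum>l<K. real l)" for K
  define S2 where "S2 K = real (A K) * (real K)\<^sup>2 + (\<Sum>l<K. (real l)\<^sup>2)" for K
  \<comment> \<open>The Gaussian rate on the grid with \<open>K\<close> cells; numerator and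
    denominator carry a factor \<open>(d K)^2\<close> so that each converges.\<close>
  define rate where "rate K = (Ma + S * (\<eta> K + c * d K) + c * ((d K)\<^sup>2 * S1 K))\<^sup>2 / (2 * ((d K) ^ 3 * S2 K))" for K
  have inv: "(\<lambda>K. 1 / real K) \<longlonglongrightarrow> 0" by (rule lim_1_over_n)
  have \<eta>_lim: "\<eta> \<longlonglongrightarrow> 0"
    unfolding \<eta>_def using tendsto_real_sqrt[OF tendsto_real_sqrt[OF inv]] by simp
  have d_lim: "d \<longlonglongrightarrow> 0"
    using tendsto_mult[OF tendsto_const[of S] inv] by (simp add: d_def[abs_def])
  have A_lim: "(\<lambda>K. real (A K) * d K) \<longlonglongrightarrow> p"
  proof (rule tendsto_sandwich)
    have A: "real (A K) \<le> p / S * real K" "p / S * real K - 1 \<le> real (A K)" for K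
      using \<open>p \<ge> 0\<close> S(1) unfolding A_def by (simp_all add: floor_correct)
    have "real (A K) * d K \<le> p" "p - d K \<le> real (A K) * d K" if "K > 0" for K
    proof -
      have "d K > 0" using that S by (simp add: d_def)
      then have "real (A K) * d K \<le> p / S * real K * d K" "(p / S * real K - 1) * d K \<le> real (A K) * d K"
        using mult_right_mono[OF A(1)[of K], of "d K"] mult_right_mono[OF A(2)[of K], of "d K"] by simp_all
      moreover have "p / S * real K * d K = p" using that S by (simp add: d_def)
      ultimately show "real (A K) * d K \<le> p" "p - d K \<le> real (A K) * d K" by (simp_all add: left_diff_distrib)
    qed
    then show "\<forall>\<^sub>F K in sequentially. real (A K) * d K \<le> p" "\<forall>\<^sub>F K in sequentially. p - d K \<le> real (A K) * d K"
      by (auto intro: eventually_mono[OF eventually_gt_at_top[of 0]])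
    show "(\<lambda>K. p - d K) \<longlonglongrightarrow> p" using tendsto_diff[OF tendsto_const[of p] d_lim] by simp
  qed simp
  \<comment> \<open>A closed form of the Riemann sum, from which the limit is read off.\<close>
  have S1_eq: "S * (real (A K) * d K) + S\<^sup>2 / 2 * (1 - 1 / real K) = (d K)\<^sup>2 * S1 K" if "K > 0" for K
  proof -
    have sum: "(\<Sum>l<K. real l) = real K * (real K - 1) / 2" by (induction K) (auto simp: field_simps)
    show ?thesis unfolding S1_def sum d_def using that S(1) by (simp add: field_simps power2_eq_square)
  qed
  have "(\<lambda>K. S * (real (A K) * d K) + S\<^sup>2 / 2 * (1 - 1 / real K)) \<longlonglongrightarrow> S * p + S\<^sup>2 / 2 * (1 - 0)"
    by (intro A_lim inv tendsto_const tendsto_add tendsto_mult tendsto_diff)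
  then have "(\<lambda>K. (d K)\<^sup>2 * S1 K) \<longlonglongrightarrow> S * p + S\<^sup>2 / 2 * (1 - 0)"
    by (rule Lim_transform_eventually) (rule eventually_mono[OF eventually_gt_at_top[of 0] S1_eq])
  then have S1_lim: "(\<lambda>K. (d K)\<^sup>2 * S1 K) \<longlonglongrightarrow> S * p + S\<^sup>2 / 2" by simp
  have S2_eq: "S\<^sup>2 * (real (A K) * d K) + S ^ 3 / 6 * ((1 - 1 / real K) * (2 - 1 / real K)) = (d K) ^ 3 * S2 K"
    if "K > 0" for K
  proof -
    have sum: "(\<Sum>l<K. (real l)\<^sup>2) = real K * (real K - 1) * (2 * real K - 1) / 6"
      by (induction K) (auto simp: field_simps power2_eq_square)
    show ?thesis
      unfolding S2_def sum d_def using that S(1) by (simp add: field_simps power2_eq_square power3_eq_cube)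
  qed
  have "(\<lambda>K. S\<^sup>2 * (real (A K) * d K) + S ^ 3 / 6 * ((1 - 1 / real K) * (2 - 1 / real K)))
      \<longlonglongrightarrow> S\<^sup>2 * p + S ^ 3 / 6 * ((1 - 0) * (2 - 0))"
    by (intro A_lim inv tendsto_const tendsto_add tendsto_mult tendsto_diff)
  then have "(\<lambda>K. (d K) ^ 3 * S2 K) \<longlonglongrightarrow> S\<^sup>2 * p + S ^ 3 / 6 * ((1 - 0) * (2 - 0))"
    by (rule Lim_transform_eventually) (rule eventually_mono[OF eventually_gt_at_top[of 0] S2_eq])
  then have S2_lim: "(\<lambda>K. (d K) ^ 3 * S2 K) \<longlonglongrightarrow> S\<^sup>2 * p + S ^ 3 / 3" by simp
  have "0 < S\<^sup>2 * p + S ^ 3 / 3" using S(1) \<open>p \<ge> 0\<close> by (intro add_nonneg_pos) auto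
  then have "rate \<longlonglongrightarrow> (Ma + S * (0 + c * 0) + c * (S * p + S\<^sup>2 / 2))\<^sup>2 / (2 * (S\<^sup>2 * p + S ^ 3 / 3))"
    unfolding rate_def
    by (intro S1_lim S2_lim \<eta>_lim d_lim tendsto_const tendsto_divide tendsto_power tendsto_add tendsto_mult) simp
  then have rate_lim: "rate \<longlonglongrightarrow> \<phi>" by (simp add: \<phi>)
  have "filterlim (\<lambda>K. sqrt (real K)) at_top sequentially"
    by (rule filterlim_compose[OF sqrt_at_top filterlim_real_sequentially])
  then have "\<forall>\<^sub>F K in sequentially. 128 * S * (\<phi> + 2 * \<epsilon>) \<le> sqrt (real K)"
    by (simp add: filterlim_at_top)
  moreover have "\<forall>\<^sub>F K in sequentially. rate K < \<phi> + \<epsilon>"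
    using \<open>\<epsilon> > 0\<close> by (intro order_tendstoD(2)[OF rate_lim]) simp
  ultimately have "\<forall>\<^sub>F K in sequentially. K > 1 \<and> 128 * S * (\<phi> + 2 * \<epsilon>) \<le> sqrt (real K) \<and> rate K < \<phi> + \<epsilon>"
    using eventually_gt_at_top[of 1] by eventually_elim auto
  then obtain K where K: "K > 1" "128 * S * (\<phi> + 2 * \<epsilon>) \<le> sqrt (real K)" "rate K < \<phi> + \<epsilon>"
    using eventually_happens'[OF sequentially_bot] by blast
  have d_pos: "d K > 0" and Kd: "real K * d K = S" using K(1) S by (auto simp: d_def)
  have \<eta>_pos: "\<eta> K > 0" using K(1) by (simp add: \<eta>_def)
  define b where "b = sqrt (real K) / (128 * S)"
  \<comment> \<open>The margin of a further \<open>\<epsilon>\<close> makes the oscillation rate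
    strictly larger than \<open>\<phi> + \<epsilon>\<close>, hence the subtracted error
    negligible.\<close>
  have "b \<ge> \<phi> + 2 * \<epsilon>"
    unfolding b_def using K(2) S(1) by (simp add: pos_le_divide_eq mult.commute mult.left_commute)
  then have b: "b > \<phi> + \<epsilon>" "b > 0" using K(1) S(1) \<open>\<epsilon> > 0\<close> by (auto simp: b_def)
  have \<eta>_d: "(\<eta> K)\<^sup>2 / (128 * d K) = b"
    using S(1) K(1) by (simp add: \<eta>_def d_def b_def real_sqrt_divide field_simps)
  \<comment> \<open>\<open>n * a\<close> is the level to be reached and \<open>n * v\<close> the
    variance at scale \<open>n\<close>.\<close>
  define a where "a = Ma / d K + real K * (\<eta> K + c * d K) + c * d K * S1 K"
  define v where "v = d K * S2 K"
  have "S1 K \<ge> 0" unfolding S1_def by (intro add_nonneg_nonneg sum_nonneg) auto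
  then have "a \<ge> 0" unfolding a_def using d_pos \<eta>_pos assms by (intro add_nonneg_nonneg) auto
  have "(\<Sum>l<K. (real l)\<^sup>2) > 0" using K(1) by (intro sum_pos2[where i=1]) auto
  then have "S2 K > 0" unfolding S2_def by (intro add_nonneg_pos) auto
  then have "v > 0" unfolding v_def using d_pos by simp
  have "d K * a = Ma + S * (\<eta> K + c * d K) + c * ((d K)\<^sup>2 * S1 K)"
    using d_pos by (simp add: a_def Kd[symmetric] algebra_simps power2_eq_square)
  then have "rate K = (d K * a)\<^sup>2 / (2 * ((d K)\<^sup>2 * v))"
    by (simp add: rate_def v_def power2_eq_square power3_eq_cube)
  also have "\<dots> = a\<^sup>2 / (2 * v)" using d_pos by (simp add: power_mult_distrib)
  finally have "a\<^sup>2 / (2 * v) < \<phi> + \<epsilon>" using K(3) by simp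
  define C where "C = real (A K + K) * 4"
  have "\<forall>\<^sub>F n in at_top. exp (- (n * a + 1)\<^sup>2 / (2 * (n * v))) / sqrt (2 * pi * (n * v)) - C * exp (- (n * b))
      \<ge> exp (- (n * (\<phi> + \<epsilon>)))"
    by (rule eventually_gaussian_tail_ge) (use \<open>a \<ge> 0\<close> \<open>v > 0\<close> \<open>a\<^sup>2 / (2 * v) < \<phi> + \<epsilon>\<close> b(1) in \<open>auto simp: C_def\<close>)
  moreover have "\<forall>\<^sub>F n in at_top. n \<ge> 1 \<and> n \<ge> 16 / b"
    by (intro eventually_conj eventually_ge_at_top)
  ultimately show ?thesis
  proof eventually_elim
    case (elim n)
    have "n > 0" using elim by simp
    have n: "n * b \<ge> 16" using elim b(2) by (simp add: pos_divide_le_eq)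
    have x: "(\<eta> K * n)\<^sup>2 / (128 * (d K * n)) = n * b"
      using \<open>n > 0\<close> by (simp add: \<eta>_d[symmetric] power2_eq_square)
    have X: "n * a = Ma * n\<^sup>2 / (d K * n) + real K * (\<eta> K * n + c * (d K * n)) + c * (d K * n) * S1 K"
      using \<open>n > 0\<close> d_pos by (simp add: a_def field_simps power2_eq_square)
    have "real K * (d K * n) = S * n" by (simp add: Kd[symmetric])
    then have t: "real K * (d K * n) \<le> T * n" using S(2) \<open>n > 0\<close> by simp
    have v: "d K * n * S2 K = n * v" by (simp add: v_def)
    have "exp (- (n * a + 1)\<^sup>2 / (2 * (d K * n * S2 K))) / sqrt (2 * pi * (d K * n * S2 K))
        - real (A K + K) * (4 * exp (- ((\<eta> K * n)\<^sup>2 / (128 * (d K * n)))))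
        \<le> prob {\<omega> \<in> space M. workload_area c B (T * n) \<omega> \<ge> ennreal (Ma * n\<^sup>2)}"
      unfolding S2_def
    proof (rule workload_area_tail_lower)
      show "0 < d K * n" "0 < \<eta> K * n" using d_pos \<eta>_pos \<open>n > 0\<close> by auto
      show "16 \<le> (\<eta> K * n)\<^sup>2 / (128 * (d K * n))" unfolding x by (rule n)
      show "n * a = Ma * n\<^sup>2 / (d K * n) + real K * (\<eta> K * n + c * (d K * n))
          + c * (d K * n) * (real (A K) * real K + (\<Sum>l<K. real l))"
        using X unfolding S1_def .
    qed (use assms K(1) t \<open>n > 0\<close> in auto)
    moreover have "C * exp (- (n * b)) = real (A K + K) * (4 * exp (- (n * b)))" by (simp add: C_def)
    ultimately show ?case
      using elim(1) unfolding x v \<phi>_def[symmetric] by linarith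
  qed
qed

end

theorem theorem2:
  fixes \<Omega> :: "'a measure" and B :: "real \<Rightarrow> 'a \<Rightarrow> real" and c T M :: real
  assumes "two_sided_brownian_motion \<Omega> B"
    and "c > 0" and "T > 0" and "M > 0"
  shows "((\<lambda>u. - (1 / sqrt u *
             ln (\<P>(\<omega> in \<Omega>. workload_area c B (T * sqrt u) \<omega> \<ge> ennreal (M * u)))))
           \<longlongrightarrow> decay_rate c T M) at_top"
proof (rule tendstoI)
  interpret two_sided_brownian_motion \<Omega> B by fact
  fix \<epsilon> :: real assume "\<epsilon> > 0"
  define \<phi> where "\<phi> = decay_rate c T M"
  define P where "P n = prob {\<omega> \<in> space \<Omega>. workload_area c B (T * n) \<omega> \<ge> ennreal (M * n\<^sup>2)}" for n
  have "\<forall>\<^sub>F n in at_top. P n \<ge> exp (- (n * (\<phi> + \<epsilon> / 2))) \<and> P n \<le> exp (- (n * (\<phi> - \<epsilon> / 2))) \<and> n > 0"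
    unfolding P_def \<phi>_def using assms \<open>\<epsilon> > 0\<close>
    by (intro eventually_conj eventually_workload_area_tail_lower eventually_workload_area_tail_upper
        eventually_gt_at_top) auto
  then have "\<forall>\<^sub>F n in at_top. dist (- (1 / n * ln (P n))) \<phi> < \<epsilon>"
  proof eventually_elim
    case (elim n)
    \<comment> \<open>The lower bound makes the probability positive, so its logarithm is
      meaningful.\<close>
    then have "P n > 0" by (auto intro: less_le_trans[OF exp_gt_zero])
    then have "- (n * (\<phi> + \<epsilon> / 2)) \<le> ln (P n)"
      using elim by (simp add: ln_ge_iff)
    moreover have "ln (P n) \<le> ln (exp (- (n * (\<phi> - \<epsilon> / 2))))"
      using elim \<open>P n > 0\<close> by (subst ln_le_cancel_iff) auto
    ultimately have "- (n * (\<phi> + \<epsilon> / 2)) \<le> ln (P n)" "ln (P n) \<le> - (n * (\<phi> - \<epsilon> / 2))"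
      by simp_all
    then have "- (1 / n * ln (P n)) \<le> \<phi> + \<epsilon> / 2" "- (1 / n * ln (P n)) \<ge> \<phi> - \<epsilon> / 2"
      using elim by (simp_all add: field_simps)
    then show ?case using \<open>\<epsilon> > 0\<close> unfolding dist_real_def by linarith
  qed
  \<comment> \<open>Substituting \<open>n = sqrt u\<close>; for \<open>u \<ge> 0\<close> the level
    \<open>M * n^2\<close> is \<open>M * u\<close>.\<close>
  then have "\<forall>\<^sub>F u in at_top. dist (- (1 / sqrt u * ln (P (sqrt u)))) \<phi> < \<epsilon>"
    using sqrt_at_top by (rule eventually_compose_filterlim)
  then show "\<forall>\<^sub>F u in at_top. dist (- (1 / sqrt u *
      ln (\<P>(\<omega> in \<Omega>. workload_area c B (T * sqrt u) \<omega> \<ge> ennreal (M * u))))) (decay_rate c T M) < \<epsilon>"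
    using eventually_ge_at_top[of 0] by eventually_elim (simp add: P_def \<phi>_def)
qed

end
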